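(* Let $(E,F)$ be a pair of dual spaces over a field $K$, let $\mathcal{B}(E)$ be the ring of all $\sigma(E,F)$-continuous linear mappings $E\to E$, and let $Proj(E)$ be the orthoposet of all continuous linear projections defined on $E$. (1) The restriction to $Proj(E)$ of an automorphism of the ring $\mathcal{B}(E)$ is an even orthoposet automorphism of $Proj(E)$, and the restriction to $Proj(E)$ of an anti-automorphism of the ring $\mathcal{B}(E)$ is an odd orthoposet automorphism of $Proj(E)$. (2) Conversely, if $\dim E\geq 4$, every even automorphism of the orthoposet $Proj(E)$ extends to an automorphism of the ring $\mathcal{B}(E)$.
   Context: Fields are not assumed commutative (i.e. they are division rings). A pair of dual spaces $(E,F)$ over a field $K$ consists of a left vector space $E$ over $K$ and a right vector space $F$ over $K$ together with a nondegenerate bilinear form $\beta:E\times F\to K$. For a subspace $G$ of $F$ put $G^\perp=\{x\in E\mid \beta(x,y)=0\text{ for every } y\in G\}$. The linear weak topology $\sigma(E,F)$ on $E$ is the translation-invariant topology for which the subspaces $G^\perp$, with $G$ a finite-dimensional subspace of $F$, form a basis of neighbourhoods of $0$; continuity of linear maps $E\to E$ refers to this topology. A continuous linear projection is an element $p\in\mathcal{B}(E)$ with $p^2=p$. The set $Proj(E)$ of these is an orthomodular poset with order $p\leq q$ if and only if $\mathrm{Im}\,p\subset \mathrm{Im}\,q$ and $\mathrm{Ker}\,q\subset\mathrm{Ker}\,p$ (equivalently $pq=qp=p$) and orthocomplementation $p^\perp=1_E-p$. An orthoposet automorphism of $Proj(E)$ is a bijection of $Proj(E)$ preserving the order in both directions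 and commuting with $\perp$. It is called even if it transforms projections with the same image into projections with the same image, and odd if it transforms projections with the same image into projections with the same kernel. An anti-automorphism of a ring is an additive bijection of the ring onto itself reversing products. *)

theory Defs
  imports
    "HOL-Analysis.Abstract_Topology"
    "HOL-Algebra.QuotRing"
    "HOL-Library.Extended_Nat"
begin

(* The vector spaces of Main and HOL-Algebra are over commutative rings or fields.  Here the
   scalars form a division ring, a right vector space having its scalars as second argument. *)

locale left_vector_space =
  fixes lscale :: "'k::division_ring \<Rightarrow> 'e::ab_group_add \<Rightarrow> 'e"
  assumes lscale_add_right: "lscale a (x + y) = lscale a x + lscale a y"
    and lscale_add_left: "lscale (a + b) x = lscale a x + lscale b x"
    and lscale_lscale: "lscale a (lscale b x) = lscale (a * b) x"
    and lscale_one: "lscale 1 x = x"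

locale right_vector_space =
  fixes rscale :: "'f::ab_group_add \<Rightarrow> 'k::division_ring \<Rightarrow> 'f"
  assumes rscale_add_left: "rscale (x + y) a = rscale x a + rscale y a"
    and rscale_add_right: "rscale x (a + b) = rscale x a + rscale x b"
    and rscale_rscale: "rscale (rscale x a) b = rscale x (a * b)"
    and rscale_one: "rscale x 1 = x"

locale dual_pair = left_vector_space lscale + right_vector_space rscale
  for lscale :: "'k::division_ring \<Rightarrow> 'e::ab_group_add \<Rightarrow> 'e"
    and rscale :: "'f::ab_group_add \<Rightarrow> 'k \<Rightarrow> 'f" +
  fixes \<beta> :: "'e \<Rightarrow> 'f \<Rightarrow> 'k"
  assumes form_add_left: "\<beta> (x + x') y = \<beta> x y + \<beta> x' y"
    and form_add_right: "\<beta> x (y + y') = \<beta> x y + \<beta> x y'"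
    and form_lscale: "\<beta> (lscale a x) y = a * \<beta> x y"
    and form_rscale: "\<beta> x (rscale y a) = \<beta> x y * a"
    and nondegenerate_left: "(\<And>y. \<beta> x y = 0) \<Longrightarrow> x = 0"
    and nondegenerate_right: "(\<And>x. \<beta> x y = 0) \<Longrightarrow> y = 0"


definition left_span :: "('k::division_ring \<Rightarrow> 'e::ab_group_add \<Rightarrow> 'e) \<Rightarrow> 'e set \<Rightarrow> 'e set" where
  "left_span lscale S = {\<Sum>v\<in>T. lscale (c v) v | T c. finite T \<and> T \<subseteq> S}"

definition left_independent :: "('k::division_ring \<Rightarrow> 'e::ab_group_add \<Rightarrow> 'e) \<Rightarrow> 'e set \<Rightarrow> bool" where
  "left_independent lscale S \<longleftrightarrow>
     (\<forall>T c. finite T \<longrightarrow> T \<subseteq> S \<longrightarrow> (\<Sum>v\<in>T. lscale (c v) v) = 0 \<longrightarrow> (\<forall>v\<in>T. c v = 0))"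

definition left_basis :: "('k::division_ring \<Rightarrow> 'e::ab_group_add \<Rightarrow> 'e) \<Rightarrow> 'e set \<Rightarrow> bool" where
  "left_basis lscale B \<longleftrightarrow> left_independent lscale B \<and> left_span lscale B = UNIV"

(* All infinite dimensions are identified with \<open>\<infinity>\<close>. *)
definition left_dim :: "('k::division_ring \<Rightarrow> 'e::ab_group_add \<Rightarrow> 'e) \<Rightarrow> enat" where
  "left_dim lscale =
     (if \<exists>B. finite B \<and> left_basis lscale B
      then enat (card (SOME B. finite B \<and> left_basis lscale B))
      else \<infinity>)"

definition right_span :: "('f::ab_group_add \<Rightarrow> 'k::division_ring \<Rightarrow> 'f) \<Rightarrow> 'f set \<Rightarrow> 'f set" where
  "right_span rscale S = {\<Sum>v\<in>T. rscale v (c v) | T c. finite T \<and> T \<subseteq> S}"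

(* The finite-dimensional subspaces are the spans of finite sets. *)
definition right_fin_dim :: "('f::ab_group_add \<Rightarrow> 'k::division_ring \<Rightarrow> 'f) \<Rightarrow> 'f set \<Rightarrow> bool" where
  "right_fin_dim rscale G \<longleftrightarrow> (\<exists>S. finite S \<and> G = right_span rscale S)"

definition left_linear ::
    "('k::division_ring \<Rightarrow> 'e::ab_group_add \<Rightarrow> 'e) \<Rightarrow> ('e \<Rightarrow> 'e) \<Rightarrow> bool" where
  "left_linear lscale f \<longleftrightarrow>
     (\<forall>x y. f (x + y) = f x + f y) \<and> (\<forall>a x. f (lscale a x) = lscale a (f x))"


definition annihilator :: "('e \<Rightarrow> 'f \<Rightarrow> 'k::zero) \<Rightarrow> 'f set \<Rightarrow> 'e set" where
  "annihilator \<beta> G = {x. \<forall>y\<in>G. \<beta> x y = 0}"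

definition weak_topology ::
    "('f::ab_group_add \<Rightarrow> 'k::division_ring \<Rightarrow> 'f) \<Rightarrow> ('e::ab_group_add \<Rightarrow> 'f \<Rightarrow> 'k) \<Rightarrow> 'e topology"
  where
  "weak_topology rscale \<beta> =
     topology (\<lambda>U. \<forall>x\<in>U. \<exists>G. right_fin_dim rscale G \<and> (\<lambda>z. x + z) ` annihilator \<beta> G \<subseteq> U)"

lemma right_fin_dim_Un:
  assumes "right_fin_dim rscale G" "right_fin_dim rscale H"
  shows "\<exists>L. right_fin_dim rscale L \<and> G \<subseteq> L \<and> H \<subseteq> L"
proof -
  obtain S T where "finite S" "G = right_span rscale S" "finite T" "H = right_span rscale T"
    using assms unfolding right_fin_dim_def by auto
  moreover have "right_span rscale A \<subseteq> right_span rscale B" if "A \<subseteq> B" for A B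
    using that unfolding right_span_def by blast
  ultimately show ?thesis
    by (intro exI[of _ "right_span rscale (S \<union> T)"]) (auto simp: right_fin_dim_def)
qed

lemma openin_weak_topology:
  "openin (weak_topology rscale \<beta>) U \<longleftrightarrow>
     (\<forall>x\<in>U. \<exists>G. right_fin_dim rscale G \<and> (\<lambda>z. x + z) ` annihilator \<beta> G \<subseteq> U)"
proof -
  have "istopology
    (\<lambda>U. \<forall>x\<in>U. \<exists>G. right_fin_dim rscale G \<and> (\<lambda>z. x + z) ` annihilator \<beta> G \<subseteq> U)"
    unfolding istopology_def
  proof (intro conjI allI impI ballI)
    fix S T x
    assume S: "\<forall>x\<in>S. \<exists>G. right_fin_dim rscale G \<and> (\<lambda>z. x + z) ` annihilator \<beta> G \<subseteq> S"
      and T: "\<forall>x\<in>T. \<exists>G. right_fin_dim rscale G \<and> (\<lambda>z. x + z) ` annihilator \<beta> G \<subseteq> T"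
      and x: "x \<in> S \<inter> T"
    obtain G where G: "right_fin_dim rscale G" "(\<lambda>z. x + z) ` annihilator \<beta> G \<subseteq> S"
      using S x by blast
    obtain H where H: "right_fin_dim rscale H" "(\<lambda>z. x + z) ` annihilator \<beta> H \<subseteq> T"
      using T x by blast
    obtain L where L: "right_fin_dim rscale L" "G \<subseteq> L" "H \<subseteq> L"
      using right_fin_dim_Un[OF G(1) H(1)] by blast
    have "annihilator \<beta> L \<subseteq> annihilator \<beta> G" "annihilator \<beta> L \<subseteq> annihilator \<beta> H"
      using L unfolding annihilator_def by auto
    then show "\<exists>G. right_fin_dim rscale G \<and> (\<lambda>z. x + z) ` annihilator \<beta> G \<subseteq> S \<inter> T"
      using G H L(1) by blast
  next
    fix \<K> x
    assume K: "\<forall>K\<in>\<K>. \<forall>x\<in>K. \<exists>G. right_fin_dim rscale G \<and> (\<lambda>z. x + z) ` annihilator \<beta> G \<subseteq> K"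
      and "x \<in> \<Union>\<K>"
    then obtain K where "K \<in> \<K>" "x \<in> K" by blast
    moreover obtain G where "right_fin_dim rscale G" "(\<lambda>z. x + z) ` annihilator \<beta> G \<subseteq> K"
      using K calculation by blast
    ultimately show "\<exists>G. right_fin_dim rscale G \<and> (\<lambda>z. x + z) ` annihilator \<beta> G \<subseteq> \<Union>\<K>"
      by blast
  qed
  then show ?thesis
    unfolding weak_topology_def by simp
qed


definition continuous_endo_ring ::
    "('k::division_ring \<Rightarrow> 'e::ab_group_add \<Rightarrow> 'e) \<Rightarrow> ('f::ab_group_add \<Rightarrow> 'k \<Rightarrow> 'f) \<Rightarrow>
     ('e \<Rightarrow> 'f \<Rightarrow> 'k) \<Rightarrow> ('e \<Rightarrow> 'e) ring" where
  "continuous_endo_ring lscale rscale \<beta> =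
     \<lparr>carrier = {f. left_linear lscale f \<and>
                    continuous_map (weak_topology rscale \<beta>) (weak_topology rscale \<beta>) f},
      monoid.mult = (\<lambda>f g. f \<circ> g), one = id,
      zero = (\<lambda>x. 0), add = (\<lambda>f g x. f x + g x)\<rparr>"

definition continuous_projections ::
    "('k::division_ring \<Rightarrow> 'e::ab_group_add \<Rightarrow> 'e) \<Rightarrow> ('f::ab_group_add \<Rightarrow> 'k \<Rightarrow> 'f) \<Rightarrow>
     ('e \<Rightarrow> 'f \<Rightarrow> 'k) \<Rightarrow> ('e \<Rightarrow> 'e) set" where
  "continuous_projections lscale rscale \<beta> =
     {p \<in> carrier (continuous_endo_ring lscale rscale \<beta>). p \<circ> p = p}"

definition kernel_of :: "('e \<Rightarrow> 'e::zero) \<Rightarrow> 'e set" where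
  "kernel_of f = {x. f x = 0}"

definition proj_le :: "('e \<Rightarrow> 'e::zero) \<Rightarrow> ('e \<Rightarrow> 'e) \<Rightarrow> bool" where
  "proj_le p q \<longleftrightarrow> range p \<subseteq> range q \<and> kernel_of q \<subseteq> kernel_of p"

definition proj_compl :: "('e \<Rightarrow> 'e::ab_group_add) \<Rightarrow> 'e \<Rightarrow> 'e" where
  "proj_compl p = (\<lambda>x. x - p x)"

(* In the following three predicates, \<open>P\<close> stands for the orthoposet of continuous projections,
   and only the values of \<open>\<phi>\<close> on \<open>P\<close> matter. *)

definition orthoposet_automorphism ::
    "('e \<Rightarrow> 'e::ab_group_add) set \<Rightarrow> (('e \<Rightarrow> 'e) \<Rightarrow> ('e \<Rightarrow> 'e)) \<Rightarrow> bool" where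
  "orthoposet_automorphism P \<phi> \<longleftrightarrow>
     bij_betw \<phi> P P \<and>
     (\<forall>p\<in>P. \<forall>q\<in>P. proj_le (\<phi> p) (\<phi> q) \<longleftrightarrow> proj_le p q) \<and>
     (\<forall>p\<in>P. \<phi> (proj_compl p) = proj_compl (\<phi> p))"

definition even_automorphism ::
    "('e \<Rightarrow> 'e::ab_group_add) set \<Rightarrow> (('e \<Rightarrow> 'e) \<Rightarrow> ('e \<Rightarrow> 'e)) \<Rightarrow> bool" where
  "even_automorphism P \<phi> \<longleftrightarrow>
     orthoposet_automorphism P \<phi> \<and>
     (\<forall>p\<in>P. \<forall>q\<in>P. range p = range q \<longrightarrow> range (\<phi> p) = range (\<phi> q))"

definition odd_automorphism ::
    "('e \<Rightarrow> 'e::ab_group_add) set \<Rightarrow> (('e \<Rightarrow> 'e) \<Rightarrow> ('e \<Rightarrow> 'e)) \<Rightarrow> bool" where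
  "odd_automorphism P \<phi> \<longleftrightarrow>
     orthoposet_automorphism P \<phi> \<and>
     (\<forall>p\<in>P. \<forall>q\<in>P. range p = range q \<longrightarrow> kernel_of (\<phi> p) = kernel_of (\<phi> q))"

definition ring_anti_automorphisms :: "('a, 'm) ring_scheme \<Rightarrow> ('a \<Rightarrow> 'a) set" where
  "ring_anti_automorphisms R =
     {h. bij_betw h (carrier R) (carrier R) \<and>
         (\<forall>x\<in>carrier R. \<forall>y\<in>carrier R. h (x \<oplus>\<^bsub>R\<^esub> y) = h x \<oplus>\<^bsub>R\<^esub> h y) \<and>
         (\<forall>x\<in>carrier R. \<forall>y\<in>carrier R. h (x \<otimes>\<^bsub>R\<^esub> y) = h y \<otimes>\<^bsub>R\<^esub> h x)}"


context dual_pair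
begin

lemma form_zero: "\<beta> 0 y = 0" "\<beta> x 0 = 0"
  using form_add_left[of 0 0 y] form_add_right[of x 0 0] by simp_all

lemma annihilator_add: "x \<in> annihilator \<beta> G \<Longrightarrow> y \<in> annihilator \<beta> G \<Longrightarrow> x + y \<in> annihilator \<beta> G"
  by (simp add: annihilator_def form_add_left)

(* The neighbourhoods of \<open>x\<close> are the supersets of the sets \<open>x + G\<^sup>\<bottom>\<close>. *)
lemma weak_topology_nbhd:
  "(\<exists>U. openin (weak_topology rscale \<beta>) U \<and> x \<in> U \<and> U \<subseteq> N) \<longleftrightarrow>
     (\<exists>G. right_fin_dim rscale G \<and> (\<lambda>z. x + z) ` annihilator \<beta> G \<subseteq> N)"
proof
  assume "\<exists>U. openin (weak_topology rscale \<beta>) U \<and> x \<in> U \<and> U \<subseteq> N"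
  then show "\<exists>G. right_fin_dim rscale G \<and> (\<lambda>z. x + z) ` annihilator \<beta> G \<subseteq> N"
    unfolding openin_weak_topology by (meson subset_trans)
next
  assume "\<exists>G. right_fin_dim rscale G \<and> (\<lambda>z. x + z) ` annihilator \<beta> G \<subseteq> N"
  then obtain G where G: "right_fin_dim rscale G" "(\<lambda>z. x + z) ` annihilator \<beta> G \<subseteq> N"
    by blast
  have "openin (weak_topology rscale \<beta>) ((\<lambda>z. x + z) ` annihilator \<beta> G)"
    unfolding openin_weak_topology using G(1) annihilator_add
    by (force simp: image_iff add.assoc)
  moreover have "x \<in> (\<lambda>z. x + z) ` annihilator \<beta> G"
    by (rule image_eqI[of _ _ 0]) (auto simp: annihilator_def form_zero)
  ultimately show "\<exists>U. openin (weak_topology rscale \<beta>) U \<and> x \<in> U \<and> U \<subseteq> N"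
    using G(2) by blast
qed

lemma topspace_weak_topology: "topspace (weak_topology rscale \<beta>) = UNIV"
proof -
  have "right_fin_dim rscale (right_span rscale {})"
    unfolding right_fin_dim_def by blast
  then have "openin (weak_topology rscale \<beta>) UNIV"
    unfolding openin_weak_topology by auto
  then show ?thesis
    using openin_subset by blast
qed

lemma continuous_linear_iff:
  assumes "left_linear lscale f"
  shows "continuous_map (weak_topology rscale \<beta>) (weak_topology rscale \<beta>) f \<longleftrightarrow>
    (\<forall>G. right_fin_dim rscale G \<longrightarrow>
       (\<exists>H. right_fin_dim rscale H \<and> f ` annihilator \<beta> H \<subseteq> annihilator \<beta> G))"
    (is "?C \<longleftrightarrow> ?R")
proof
  have add: "f (x + y) = f x + f y" for x y
    using assms by (simp add: left_linear_def)
  then have zero: "f 0 = 0"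
    by (metis add_cancel_right_right add_0)
  show ?R if C: ?C
  proof (intro allI impI)
    fix G assume "right_fin_dim rscale G"
    then obtain U where U: "openin (weak_topology rscale \<beta>) U" "0 \<in> U" "U \<subseteq> annihilator \<beta> G"
      using weak_topology_nbhd[of 0 "annihilator \<beta> G"] by auto
    have "openin (weak_topology rscale \<beta>) {x. f x \<in> U}"
      using openin_continuous_map_preimage[OF C U(1)] topspace_weak_topology by simp
    then obtain H where "right_fin_dim rscale H" "(\<lambda>z. 0 + z) ` annihilator \<beta> H \<subseteq> {x. f x \<in> U}"
      unfolding openin_weak_topology using U(2) zero by (metis mem_Collect_eq)
    then show "\<exists>H. right_fin_dim rscale H \<and> f ` annihilator \<beta> H \<subseteq> annihilator \<beta> G"
      using U(3) by fastforce
  qed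
  show ?C if R: ?R
    unfolding continuous_map_def topspace_weak_topology
  proof (intro conjI allI impI)
    fix U assume U: "openin (weak_topology rscale \<beta>) U"
    show "openin (weak_topology rscale \<beta>) {x \<in> UNIV. f x \<in> U}"
      unfolding openin_weak_topology
    proof
      fix x assume "x \<in> {x \<in> UNIV. f x \<in> U}"
      then obtain G where G: "right_fin_dim rscale G" "(\<lambda>z. f x + z) ` annihilator \<beta> G \<subseteq> U"
        using U unfolding openin_weak_topology by blast
      obtain H where "right_fin_dim rscale H" "f ` annihilator \<beta> H \<subseteq> annihilator \<beta> G"
        using R G(1) by blast
      then show "\<exists>G. right_fin_dim rscale G \<and>
          (\<lambda>z. x + z) ` annihilator \<beta> G \<subseteq> {x \<in> UNIV. f x \<in> U}"
        using G(2) by (intro exI[of _ H]) (auto simp: add image_subset_iff)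
    qed
  qed simp
qed

lemma ring_continuous_endo_ring: "ring (continuous_endo_ring lscale rscale \<beta>)"
proof -
  let ?T = "weak_topology rscale \<beta>"
  let ?L = "\<lambda>f. left_linear lscale f \<and> continuous_map ?T ?T f"
  have scale0: "lscale a 0 = 0" and scale_minus: "lscale a (- x) = - lscale a x" for a x
  proof -
    show z: "lscale a 0 = 0"
      using lscale_add_right[of a 0 0] by simp
    show "lscale a (- x) = - lscale a x"
      using lscale_add_right[of a "- x" x] z by (simp add: eq_neg_iff_add_eq_0)
  qed
  have zero: "?L (\<lambda>x. 0)"
    using topspace_weak_topology by (simp add: left_linear_def scale0)
  have plus: "?L (\<lambda>x. f x + g x)" if f: "?L f" and g: "?L g" for f g
  proof -
    have lin: "left_linear lscale (\<lambda>x. f x + g x)"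
      using f g by (simp add: left_linear_def lscale_add_right algebra_simps)
    moreover have "\<exists>H. right_fin_dim rscale H \<and>
        (\<lambda>x. f x + g x) ` annihilator \<beta> H \<subseteq> annihilator \<beta> G"
      if G: "right_fin_dim rscale G" for G
    proof -
      obtain H where H: "right_fin_dim rscale H" "f ` annihilator \<beta> H \<subseteq> annihilator \<beta> G"
        using f G continuous_linear_iff by blast
      obtain I where I: "right_fin_dim rscale I" "g ` annihilator \<beta> I \<subseteq> annihilator \<beta> G"
        using g G continuous_linear_iff by blast
      obtain J where J: "right_fin_dim rscale J" "H \<subseteq> J" "I \<subseteq> J"
        using right_fin_dim_Un[OF H(1) I(1)] by blast
      have "annihilator \<beta> J \<subseteq> annihilator \<beta> H" "annihilator \<beta> J \<subseteq> annihilator \<beta> I"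
        using J by (auto simp: annihilator_def)
      then have "(\<lambda>x. f x + g x) ` annihilator \<beta> J \<subseteq> annihilator \<beta> G"
        using H(2) I(2) by (intro image_subsetI annihilator_add) blast+
      then show ?thesis
        using J(1) by blast
    qed
    ultimately show ?thesis
      using continuous_linear_iff[OF lin] by blast
  qed
  have minus: "?L (\<lambda>x. - f x)" if f: "?L f" for f
  proof -
    have lin: "left_linear lscale (\<lambda>x. - f x)"
      using f by (simp add: left_linear_def scale_minus)
    have "- y \<in> annihilator \<beta> G" if "y \<in> annihilator \<beta> G" for y G
    proof -
      have "\<beta> (- y) z = - \<beta> y z" for z
        using form_add_left[of "- y" y z] form_zero by (simp add: eq_neg_iff_add_eq_0)
      then show ?thesis
        using that by (simp add: annihilator_def)
    qed
    then show ?thesis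
      using f lin continuous_linear_iff[OF lin] continuous_linear_iff[of f]
      by (simp add: image_subset_iff) meson
  qed
  have comp: "?L (f \<circ> g)" if "?L f" "?L g" for f g
    using that continuous_map_compose[of ?T ?T g ?T f] by (auto simp: left_linear_def)
  have ident: "?L id"
    by (simp add: left_linear_def)
  show ?thesis
  proof (rule ringI)
    show "abelian_group (continuous_endo_ring lscale rscale \<beta>)"
    proof (rule abelian_groupI, goal_cases)
      case (6 f)
      then show ?case
        using minus[of f]
        by (intro bexI[of _ "\<lambda>x. - f x"]) (auto simp: continuous_endo_ring_def)
    qed (use zero plus in \<open>auto simp: continuous_endo_ring_def algebra_simps\<close>)
    show "monoid (continuous_endo_ring lscale rscale \<beta>)"
      by (rule monoidI) (use comp ident in \<open>auto simp: continuous_endo_ring_def o_assoc\<close>)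
  qed (auto simp: continuous_endo_ring_def left_linear_def fun_eq_iff)
qed

end

end

theory Submission
  imports Defs
begin

text \<open>
  \<^bold>\<open>Part (1).\<close> The order of projections, equality of images, equality of kernels and the
  complement are all expressed by ring equations: \<open>p \<le> q\<close> means \<open>pq = qp = p\<close>, the
  projections \<open>p\<close> and \<open>q\<close> have the same image iff \<open>pq = q\<close> and \<open>qp = p\<close>, they have the
  same kernel iff \<open>pq = p\<close> and \<open>qp = q\<close>, and \<open>p\<^sup>\<bottom> = 1 - p\<close>.  A map that preserves products
  preserves these equations.  One that reverses products exchanges the equations for images with
  those for kernels.

  \<^bold>\<open>Part (2).\<close> The atoms of \<open>Proj(E)\<close> are the projections onto a line \<open>Kx\<close> along a closed
  hyperplane \<open>y\<^sup>\<bottom>\<close> with \<open>\<beta>(x,y) \<noteq> 0\<close> (\<open>atomic_iff_line_projection\<close>).  An even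
  automorphism permutes them, and as it respects equality of images and, through \<open>\<bottom>\<close>,
  equality of kernels, it acts on the lines of \<open>E\<close> and on the lines of \<open>F\<close> separately.  The
  two actions preserve the relation \<open>\<beta>(x,y) = 0\<close> in both directions, because a line and a
  hyperplane are complementary iff they are the image and the kernel of an atom
  (\<open>orthogonality_preserved\<close>).

  A pair of actions on lines that preserves orthogonality preserves the planes of \<open>E\<close>, since
  a plane is its own double annihilator.  Hence the fundamental theorem of projective geometry
  gives a semilinear bijection \<open>S\<close> of \<open>E\<close> which induces the action
  (\<open>semilinear_bijection_exists\<close>).  Here the dimension of \<open>E\<close> enters, in the form that no
  two vectors span \<open>E\<close>.  Conjugation by \<open>S\<close> is an automorphism of the ring: it respects
  continuity because \<open>S\<close> maps closed hyperplanes to closed hyperplanes.  On atoms it agrees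
  with the given automorphism, both results having the same image and the same kernel.  As a
  projection is determined by the atoms below it (\<open>orthoposet_automorphism_eqI\<close>), the two
  agree on all of \<open>Proj(E)\<close>.

  The proof of the fundamental theorem works in an affine chart.  Choose \<open>e\<close> and \<open>y\<^sub>0\<close> with
  \<open>\<beta>(e,y\<^sub>0) = 1\<close> and let \<open>H = y\<^sub>0\<^sup>\<bottom>\<close>.  The lines outside \<open>H\<close> correspond to the points of
  the affine hyperplane \<open>e + H\<close>, and similarly with \<open>e'\<close> and \<open>H'\<close> for their images, so the
  action on lines becomes a bijection \<open>e + x \<mapsto> e' + s(x)\<close> with \<open>s(0) = 0\<close>.  The plane through
  two affine points meets \<open>H\<close> in the line of their difference; hence \<open>s(x) - s(z)\<close> spans the
  image of the line of \<open>x - z\<close>.  Completing parallelograms, one finds that \<open>s\<close> is additive,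
  and comparing multiples of independent vectors, that \<open>s\<close> is semilinear.  Then \<open>S\<close> is the
  semilinear extension of \<open>s\<close> with \<open>S(e) = e'\<close>.
\<close>

section \<open>Vectors and forms over a division ring\<close>

context left_vector_space
begin

lemma scale_zero_right: "lscale a 0 = 0"
  using lscale_add_right[of a 0 0] by simp

lemma scale_zero_left: "lscale 0 x = 0"
  using lscale_add_left[of 0 0 x] by simp

lemma scale_minus_right: "lscale a (- x) = - lscale a x"
  using lscale_add_right[of a "- x" x] by (simp add: eq_neg_iff_add_eq_0 scale_zero_right)

lemma scale_minus_left: "lscale (- a) x = - lscale a x"
  using lscale_add_left[of "- a" a x] by (simp add: eq_neg_iff_add_eq_0 scale_zero_left)

lemma scale_diff_right: "lscale a (x - y) = lscale a x - lscale a y"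
  using lscale_add_right[of a x "- y"] by (simp add: scale_minus_right)

lemma scale_diff_left: "lscale (a - b) x = lscale a x - lscale b x"
  using lscale_add_left[of a "- b" x] by (simp add: scale_minus_left)

lemma scale_inverse: "a \<noteq> 0 \<Longrightarrow> lscale (inverse a) (lscale a x) = x"
  by (simp add: lscale_lscale lscale_one)

lemma scale_eq_0_iff: "lscale a x = 0 \<longleftrightarrow> a = 0 \<or> x = 0"
  by (metis scale_inverse scale_zero_left scale_zero_right)

lemma eq_scale_of_scale_eq:
  assumes "lscale a x = lscale b y" "a \<noteq> 0"
  shows "x = lscale (inverse a * b) y"
  by (metis assms lscale_lscale scale_inverse)

lemma scale_sum: "lscale a (\<Sum>v\<in>T. g v) = (\<Sum>v\<in>T. lscale a (g v))"
  by (induction T rule: infinite_finite_induct) (simp_all add: scale_zero_right lscale_add_right)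

lemmas scale_simps = scale_zero_right scale_zero_left scale_minus_right scale_minus_left
  scale_diff_right scale_diff_left lscale_add_right lscale_add_left lscale_lscale lscale_one

end

context dual_pair
begin

lemma form_minus_left: "\<beta> (- x) y = - \<beta> x y"
  using form_add_left[of "- x" x y] by (simp add: eq_neg_iff_add_eq_0 form_zero)

lemma form_minus_right: "\<beta> x (- y) = - \<beta> x y"
  using form_add_right[of x "- y" y] by (simp add: eq_neg_iff_add_eq_0 form_zero)

lemma form_diff_left: "\<beta> (x - x') y = \<beta> x y - \<beta> x' y"
  using form_add_left[of x "- x'" y] by (simp add: form_minus_left)

lemma form_diff_right: "\<beta> x (y - y') = \<beta> x y - \<beta> x y'"
  using form_add_right[of x y "- y'"] by (simp add: form_minus_right)

lemmas form_simps = form_zero form_add_left form_add_right form_minus_left form_minus_right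
  form_diff_left form_diff_right form_lscale form_rscale

lemma form_sum_right: "\<beta> x (\<Sum>v\<in>T. g v) = (\<Sum>v\<in>T. \<beta> x (g v))"
  by (induction T rule: infinite_finite_induct) (simp_all add: form_zero form_add_right)

lemma eq_by_form_left: "(\<And>y. \<beta> x y = \<beta> x' y) \<Longrightarrow> x = x'"
  using nondegenerate_left[of "x - x'"] by (simp add: form_diff_left)

lemma eq_by_form_right: "(\<And>x. \<beta> x y = \<beta> x y') \<Longrightarrow> y = y'"
  using nondegenerate_right[of "y - y'"] by (simp add: form_diff_right)

lemma unit_functional:
  assumes "x \<noteq> 0"
  obtains y where "\<beta> x y = 1"
proof -
  obtain y where "\<beta> x y \<noteq> 0"
    using assms nondegenerate_left by blast
  then have "\<beta> x (rscale y (inverse (\<beta> x y))) = 1"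
    by (simp add: form_rscale)
  then show thesis
    by (rule that)
qed

lemma unit_vector:
  assumes "y \<noteq> 0"
  obtains x where "\<beta> x y = 1"
proof -
  obtain x where "\<beta> x y \<noteq> 0"
    using assms nondegenerate_right by blast
  then have "\<beta> (lscale (inverse (\<beta> x y)) x) y = 1"
    by (simp add: form_lscale)
  then show thesis
    by (rule that)
qed

text \<open>A vector \<open>z\<close> with \<open>\<beta>(u,z) = 1\<close> splits every \<open>y\<close> into a multiple of \<open>z\<close> and an element
  orthogonal to \<open>u\<close>, so that \<open>x\<close> acts on \<open>F\<close> as \<open>\<beta>(x,z)u\<close>.  This and the analogue for
  planes say that finite-dimensional subspaces are their own double annihilators; it is how
  statements about orthogonality are turned into statements about lines and planes.\<close>

lemma in_line_if_perp:
  assumes "\<And>y. \<beta> u y = 0 \<Longrightarrow> \<beta> x y = 0"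
  shows "\<exists>a. x = lscale a u"
proof (cases "u = 0")
  case True
  then have "x = 0"
    using assms nondegenerate_left by (simp add: form_zero)
  then show ?thesis
    using scale_zero_left by metis
next
  case False
  then obtain z where z: "\<beta> u z = 1"
    by (rule unit_functional)
  have "\<beta> x y = \<beta> (lscale (\<beta> x z) u) y" for y
    using assms[of "y - rscale z (\<beta> u y)"] by (simp add: form_simps z)
  then show ?thesis
    using eq_by_form_left by blast
qed

lemma in_right_line_if_perp:
  assumes "\<And>x. \<beta> x v = 0 \<Longrightarrow> \<beta> x y = 0"
  shows "\<exists>a. y = rscale v a"
proof (cases "v = 0")
  case True
  then have "y = 0"
    using assms nondegenerate_right by (simp add: form_zero)
  moreover have "rscale 0 0 = 0"
    using rscale_add_left[of 0 0 0] by simp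
  ultimately show ?thesis
    using True by metis
next
  case False
  then obtain z where z: "\<beta> z v = 1"
    by (rule unit_vector)
  have "\<beta> x y = \<beta> x (rscale v (\<beta> z y))" for x
    using assms[of "x - lscale (\<beta> x v) z"] by (simp add: form_simps z)
  then show ?thesis
    using eq_by_form_right by blast
qed

text \<open>Subtracting a multiple of \<open>v\<close> that is read off from some \<open>z\<close> with \<open>\<beta>(u,z) = 0\<close> and
  \<open>\<beta>(v,z) = 1\<close> reduces the claim to that for the line of \<open>u\<close>.\<close>

lemma in_plane_if_perp:
  assumes "\<And>y. \<beta> u y = 0 \<Longrightarrow> \<beta> v y = 0 \<Longrightarrow> \<beta> x y = 0"
  shows "\<exists>a b. x = lscale a u + lscale b v"
proof (cases "\<forall>y. \<beta> u y = 0 \<longrightarrow> \<beta> v y = 0")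
  case True
  then obtain a where "x = lscale a u"
    using in_line_if_perp assms by blast
  then have "x = lscale a u + lscale 0 v"
    by (simp add: scale_zero_left)
  then show ?thesis
    by blast
next
  case False
  then obtain y where "\<beta> u y = 0" "\<beta> v y \<noteq> 0"
    by blast
  then have "\<beta> u (rscale y (inverse (\<beta> v y))) = 0" "\<beta> v (rscale y (inverse (\<beta> v y))) = 1"
    by (simp_all add: form_rscale)
  then obtain z where z: "\<beta> u z = 0" "\<beta> v z = 1"
    by blast
  have "\<beta> (x - lscale (\<beta> x z) v) y = 0" if "\<beta> u y = 0" for y
    using assms[of "y - rscale z (\<beta> v y)"] that by (simp add: form_simps z)
  then obtain a where "x - lscale (\<beta> x z) v = lscale a u"
    using in_line_if_perp by blast
  then show ?thesis
    by (metis diff_add_cancel)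
qed

text \<open>This is the finite-dimensional part of the theory of the weak topology: a functional that is
  continuous, hence zero on a basic neighbourhood of \<open>0\<close>, is represented by a vector of \<open>F\<close>.
  In the induction, a vector \<open>z\<close> with \<open>\<beta>(z,t) = 1\<close> that is orthogonal to the remaining elements of
  \<open>T\<close> gives the coefficient \<open>g(z)\<close> of \<open>t\<close>.\<close>

lemma functional_represented:
  assumes "finite T"
    and "\<And>x x'. g (x + x') = g x + g x'" "\<And>a x. g (lscale a x) = a * g x"
    and "\<And>x. (\<And>t. t \<in> T \<Longrightarrow> \<beta> x t = 0) \<Longrightarrow> g x = 0"
  shows "\<exists>y. \<forall>x. g x = \<beta> x y"
  using assms
proof (induction T arbitrary: g rule: finite_induct)
  case empty
  then show ?case
    by (metis empty_iff form_zero(2))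
next
  case (insert t T)
  note add = insert.prems(1) and scale = insert.prems(2) and van = insert.prems(3)
  show ?case
  proof (cases "\<exists>z. (\<forall>s\<in>T. \<beta> z s = 0) \<and> \<beta> z t \<noteq> 0")
    case False
    then show ?thesis
      using insert.IH[OF add scale] van by (metis insert_iff)
  next
    case True
    then obtain z' where z': "\<forall>s\<in>T. \<beta> z' s = 0" "\<beta> z' t \<noteq> 0"
      by blast
    define z where "z = lscale (inverse (\<beta> z' t)) z'"
    have z: "\<And>s. s \<in> T \<Longrightarrow> \<beta> z s = 0" "\<beta> z t = 1"
      using z' by (simp_all add: z_def form_lscale)
    have diff: "g (x - x') = g x - g x'" for x x'
      using add[of "x - x'" x'] by simp
    have "g x - \<beta> x t * g z = 0" if "\<And>s. s \<in> T \<Longrightarrow> \<beta> x s = 0" for x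
    proof -
      have "\<beta> (x - lscale (\<beta> x t) z) s = 0" if "s \<in> insert t T" for s
        using that \<open>\<And>s. s \<in> T \<Longrightarrow> \<beta> x s = 0\<close> z by (auto simp: form_diff_left form_lscale)
      then have "g (x - lscale (\<beta> x t) z) = 0"
        by (rule van)
      then show ?thesis
        by (simp add: diff scale)
    qed
    then have "\<exists>y. \<forall>x. g x - \<beta> x t * g z = \<beta> x y"
      by (intro insert.IH) (simp_all add: add scale form_simps algebra_simps)
    then obtain y where y: "\<And>x. g x - \<beta> x t * g z = \<beta> x y"
      by blast
    have "g x = \<beta> x (y + rscale t (g z))" for x
      using y[of x] by (simp add: form_simps algebra_simps)
    then show ?thesis
      by blast
  qed
qed

lemma annihilator_right_span: "annihilator \<beta> (right_span rscale T) = {x. \<forall>t\<in>T. \<beta> x t = 0}"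
proof -
  have "t \<in> right_span rscale T" if "t \<in> T" for t
    unfolding right_span_def using that
    by (auto intro!: exI[of _ "{t}"] exI[of _ "\<lambda>_. 1"] simp: rscale_one)
  moreover have "\<beta> x y = 0" if x: "\<forall>t\<in>T. \<beta> x t = 0" and y: "y \<in> right_span rscale T" for x y
  proof -
    obtain T' c where "T' \<subseteq> T" "y = (\<Sum>v\<in>T'. rscale v (c v))"
      using y unfolding right_span_def by blast
    then show ?thesis
      using x by (auto simp: form_sum_right form_rscale intro!: sum.neutral)
  qed
  ultimately show ?thesis
    unfolding annihilator_def by blast
qed

abbreviation "\<R> \<equiv> continuous_endo_ring lscale rscale \<beta>"
abbreviation "\<P> \<equiv> continuous_projections lscale rscale \<beta>"

lemma endo_ring_ops:
  "f \<otimes>\<^bsub>\<R>\<^esub> g = f \<circ> g" "f \<oplus>\<^bsub>\<R>\<^esub> g = (\<lambda>x. f x + g x)" "\<one>\<^bsub>\<R>\<^esub> = id"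
  by (simp_all add: continuous_endo_ring_def)

text \<open>For continuous \<open>f\<close> each functional \<open>\<beta>(f(-),y)\<close> vanishes on a basic neighbourhood of \<open>0\<close>, so
  \<open>functional_represented\<close> provides an adjoint of \<open>f\<close>.  The first criterion is formally weaker than
  the existence of an adjoint; as it speaks of orthogonality only, it can be checked for maps
  conjugated by a semilinear one.\<close>

lemma endo_iff:
  assumes lin: "left_linear lscale f"
  shows "f \<in> carrier \<R> \<longleftrightarrow> (\<forall>y. \<exists>y'. \<forall>x. \<beta> x y' = 0 \<longrightarrow> \<beta> (f x) y = 0)"
    and "f \<in> carrier \<R> \<longleftrightarrow> (\<exists>g. \<forall>x y. \<beta> (f x) y = \<beta> x (g y))"
proof -
  let ?A = "\<exists>g. \<forall>x y. \<beta> (f x) y = \<beta> x (g y)"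
  let ?W = "\<forall>y. \<exists>y'. \<forall>x. \<beta> x y' = 0 \<longrightarrow> \<beta> (f x) y = 0"
  let ?C = "\<forall>G. right_fin_dim rscale G \<longrightarrow>
       (\<exists>H. right_fin_dim rscale H \<and> f ` annihilator \<beta> H \<subseteq> annihilator \<beta> G)"
  have mem: "f \<in> carrier \<R> \<longleftrightarrow> ?C"
    using lin continuous_linear_iff[OF lin] by (simp add: continuous_endo_ring_def)
  have "?A" if C: ?C
  proof -
    have "\<exists>z. \<forall>x. \<beta> (f x) y = \<beta> x z" for y
    proof -
      have "right_fin_dim rscale (right_span rscale {y})"
        unfolding right_fin_dim_def by blast
      then obtain H where H: "right_fin_dim rscale H"
          "f ` annihilator \<beta> H \<subseteq> annihilator \<beta> (right_span rscale {y})"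
        using C by meson
      then obtain T where T: "finite T"
          "f ` annihilator \<beta> (right_span rscale T) \<subseteq> annihilator \<beta> (right_span rscale {y})"
        unfolding right_fin_dim_def by auto
      show ?thesis
      proof (rule functional_represented[OF T(1)])
        show "\<beta> (f x) y = 0" if "\<And>t. t \<in> T \<Longrightarrow> \<beta> x t = 0" for x
          using T(2) that by (auto simp: annihilator_right_span)
      qed (use lin in \<open>simp_all add: left_linear_def form_add_left form_lscale\<close>)
    qed
    then show ?A
      by metis
  qed
  moreover have ?W if ?A
    using that by metis
  moreover have ?C if ?W
  proof (intro allI impI)
    fix G assume "right_fin_dim rscale G"
    then obtain T where T: "finite T" "G = right_span rscale T"
      unfolding right_fin_dim_def by blast
    obtain k where k: "\<And>x y. \<beta> x (k y) = 0 \<Longrightarrow> \<beta> (f x) y = 0"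
      using \<open>?W\<close> by metis
    show "\<exists>H. right_fin_dim rscale H \<and> f ` annihilator \<beta> H \<subseteq> annihilator \<beta> G"
      using T k by (intro exI[of _ "right_span rscale (k ` T)"])
        (auto simp: annihilator_right_span right_fin_dim_def)
  qed
  ultimately show "f \<in> carrier \<R> \<longleftrightarrow> ?W" "f \<in> carrier \<R> \<longleftrightarrow> ?A"
    using mem by blast+
qed

lemma endo_linear: "f \<in> carrier \<R> \<Longrightarrow> left_linear lscale f"
  by (simp add: continuous_endo_ring_def)

lemma endo_adjoint:
  assumes "f \<in> carrier \<R>"
  obtains g where "\<And>x y. \<beta> (f x) y = \<beta> x (g y)"
  using assms endo_iff(2) endo_linear by metis

text \<open>Linearity comes for free: both sides of the linearity equations have the same products with
  all elements of \<open>F\<close>.\<close>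

lemma endo_if_adjoint:
  assumes "\<And>x y. \<beta> (f x) y = \<beta> x (g y)"
  shows "f \<in> carrier \<R>"
proof -
  have "left_linear lscale f"
    unfolding left_linear_def
    by (intro conjI allI eq_by_form_left) (simp_all add: assms form_simps)
  then show ?thesis
    using assms endo_iff(2) by blast
qed

lemma endo_comp: "f \<in> carrier \<R> \<Longrightarrow> g \<in> carrier \<R> \<Longrightarrow> f \<circ> g \<in> carrier \<R>"
  using ring.ring_simprules(5)[OF ring_continuous_endo_ring] by (simp add: endo_ring_ops)

section \<open>Idempotents\<close>

lemma projectionD:
  assumes "p \<in> \<P>"
  shows "p \<in> carrier \<R>" "p (p x) = p x" "p (x + y) = p x + p y" "p (x - y) = p x - p y"
    "p (lscale a x) = lscale a (p x)" "p 0 = 0"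
proof -
  show "p \<in> carrier \<R>"
    using assms by (simp add: continuous_projections_def)
  then have "left_linear lscale p"
    by (rule endo_linear)
  then show add: "p (x + y) = p x + p y" and "p (lscale a x) = lscale a (p x)" for x y a
    by (simp_all add: left_linear_def)
  show "p (p x) = p x"
    using assms by (simp add: continuous_projections_def fun_eq_iff)
  show "p (x - y) = p x - p y" "p 0 = 0"
    using add[of "x - y" y] add[of 0 0] by simp_all
qed

lemma projection_in_range_iff: "p \<in> \<P> \<Longrightarrow> x \<in> range p \<longleftrightarrow> p x = x"
  by (metis projectionD(2) rangeE rangeI)

lemma range_subset_iff:
  assumes "q \<in> \<P>"
  shows "range p \<subseteq> range q \<longleftrightarrow> q \<circ> p = p"
  using projection_in_range_iff[OF assms] by (auto simp: fun_eq_iff)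

lemma proj_le_iff:
  assumes "p \<in> \<P>" "q \<in> \<P>"
  shows "proj_le p q \<longleftrightarrow> p \<circ> q = p \<and> q \<circ> p = p"
proof -
  have "kernel_of q \<subseteq> kernel_of p \<longleftrightarrow> p \<circ> q = p"
  proof
    assume "kernel_of q \<subseteq> kernel_of p"
    moreover have "x - q x \<in> kernel_of q" for x
      by (simp add: kernel_of_def projectionD[OF assms(2)])
    ultimately have "p (x - q x) = 0" for x
      by (auto simp: kernel_of_def)
    then show "p \<circ> q = p"
      by (simp add: fun_eq_iff projectionD[OF assms(1)])
  next
    assume "p \<circ> q = p"
    then show "kernel_of q \<subseteq> kernel_of p"
      by (auto simp: kernel_of_def fun_eq_iff) (metis projectionD(6)[OF assms(1)])
  qed
  then show ?thesis
    using range_subset_iff[OF assms(2)] unfolding proj_le_def by blast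
qed

lemma proj_compl_mem:
  assumes "p \<in> \<P>"
  shows "proj_compl p \<in> \<P>"
proof -
  obtain g where g: "\<And>x y. \<beta> (p x) y = \<beta> x (g y)"
    using endo_adjoint projectionD(1)[OF assms] by blast
  have "proj_compl p \<in> carrier \<R>"
    by (rule endo_if_adjoint[where g = "\<lambda>y. y - g y"]) (simp add: proj_compl_def form_simps g)
  then show ?thesis
    by (simp add: continuous_projections_def proj_compl_def fun_eq_iff projectionD[OF assms])
qed

lemma kernel_eq_range_compl:
  assumes "p \<in> \<P>"
  shows "kernel_of p = range (proj_compl p)"
proof -
  have "x \<in> kernel_of p \<longleftrightarrow> proj_compl p x = x" for x
    by (auto simp: kernel_of_def proj_compl_def)
  then show ?thesis
    using projection_in_range_iff[OF proj_compl_mem[OF assms]] by blast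
qed

lemma range_eq_iff:
  assumes "p \<in> \<P>" "q \<in> \<P>"
  shows "range p = range q \<longleftrightarrow> p \<circ> q = q \<and> q \<circ> p = p"
  using assms range_subset_iff by blast

lemma kernel_eq_if:
  assumes "p \<in> \<P>" "q \<in> \<P>" "p \<circ> q = p" "q \<circ> p = q"
  shows "kernel_of p = kernel_of q"
  using assms(3,4) projectionD(6)[OF assms(1)] projectionD(6)[OF assms(2)]
  by (auto simp: kernel_of_def fun_eq_iff) metis+

lemma projection_eqI:
  assumes "p \<in> \<P>" "q \<in> \<P>" "range p = range q" "kernel_of p = kernel_of q"
  shows "p = q"
  using assms proj_le_iff[of p q] proj_le_iff[of q p] unfolding proj_le_def by auto

section \<open>Ring automorphisms act on projections\<close>

text \<open>The equations \<open>pq = p\<close> and \<open>qp = p\<close> that describe the order are exchanged when products are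
  reversed, so automorphisms and anti-automorphisms can be treated together.\<close>

lemma orthoposet_automorphism_of_ring_map:
  assumes bij: "bij_betw h (carrier \<R>) (carrier \<R>)"
    and add: "\<And>f g. f \<in> carrier \<R> \<Longrightarrow> g \<in> carrier \<R> \<Longrightarrow> h (\<lambda>x. f x + g x) = (\<lambda>x. h f x + h g x)"
    and id: "h id = id"
    and mult: "(\<forall>f\<in>carrier \<R>. \<forall>g\<in>carrier \<R>. h (f \<circ> g) = h f \<circ> h g) \<or>
      (\<forall>f\<in>carrier \<R>. \<forall>g\<in>carrier \<R>. h (f \<circ> g) = h g \<circ> h f)"
  shows "orthoposet_automorphism \<P> (restrict h \<P>)" "p \<in> \<P> \<Longrightarrow> h p \<in> \<P>"
proof -
  have carr: "h f \<in> carrier \<R>" if "f \<in> carrier \<R>" for f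
    using bij that bij_betwE by blast
  have inj: "h f = h g \<longleftrightarrow> f = g" if "f \<in> carrier \<R>" "g \<in> carrier \<R>" for f g
    using bij that unfolding bij_betw_def by (metis inj_on_eq_iff)
  have sub: "f \<in> \<P> \<longleftrightarrow> f \<in> carrier \<R> \<and> f \<circ> f = f" for f
    by (simp add: continuous_projections_def)
  have idem: "h f \<in> \<P> \<longleftrightarrow> f \<in> \<P>" if f: "f \<in> carrier \<R>" for f
  proof -
    have "h f \<circ> h f = h (f \<circ> f)"
      using mult f by auto
    then show ?thesis
      using f carr inj[OF endo_comp[OF f f] f] by (simp add: sub)
  qed
  then show mem: "h p \<in> \<P>" if "p \<in> \<P>" for p
    using that sub by blast
  have "h ` \<P> = \<P>"
  proof
    show "\<P> \<subseteq> h ` \<P>"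
    proof
      fix q assume q: "q \<in> \<P>"
      then obtain f where "f \<in> carrier \<R>" "q = h f"
        using bij sub unfolding bij_betw_def by blast
      then show "q \<in> h ` \<P>"
        using q idem by blast
    qed
  qed (use mem in blast)
  moreover have "inj_on h \<P>"
    using inj sub by (auto intro: inj_onI)
  ultimately have "bij_betw (restrict h \<P>) \<P> \<P>"
    by (simp add: bij_betw_def)
  moreover have "proj_le (h p) (h q) \<longleftrightarrow> proj_le p q" if p: "p \<in> \<P>" and q: "q \<in> \<P>" for p q
  proof -
    have c: "p \<in> carrier \<R>" "q \<in> carrier \<R>" "p \<circ> q \<in> carrier \<R>" "q \<circ> p \<in> carrier \<R>"
      using p q sub endo_comp by auto
    have "h p \<circ> h q = h p \<and> h q \<circ> h p = h p \<longleftrightarrow> h (p \<circ> q) = h p \<and> h (q \<circ> p) = h p"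
      using mult c by metis
    then show ?thesis
      using inj c proj_le_iff[OF p q] proj_le_iff[OF mem[OF p] mem[OF q]] by simp
  qed
  moreover have "h (proj_compl p) = proj_compl (h p)" if p: "p \<in> \<P>" for p
  proof -
    have "h (\<lambda>x. p x + proj_compl p x) = (\<lambda>x. h p x + h (proj_compl p) x)"
      using p proj_compl_mem[OF p] sub add by blast
    moreover have "(\<lambda>x. p x + proj_compl p x) = id"
      by (simp add: proj_compl_def fun_eq_iff)
    ultimately have "h p x + h (proj_compl p) x = x" for x
      using id by (metis id_apply)
    then show ?thesis
      by (metis add_diff_cancel_left' ext proj_compl_def)
  qed
  ultimately show "orthoposet_automorphism \<P> (restrict h \<P>)"
    using proj_compl_mem by (simp add: orthoposet_automorphism_def)
qed

lemma even_automorphism_of_ring_iso: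
  assumes "h \<in> ring_iso \<R> \<R>"
  shows "even_automorphism \<P> (restrict h \<P>)"
proof -
  have bij: "bij_betw h (carrier \<R>) (carrier \<R>)"
    and mult: "\<And>f g. f \<in> carrier \<R> \<Longrightarrow> g \<in> carrier \<R> \<Longrightarrow> h (f \<circ> g) = h f \<circ> h g"
    and add: "\<And>f g. f \<in> carrier \<R> \<Longrightarrow> g \<in> carrier \<R> \<Longrightarrow>
        h (\<lambda>x. f x + g x) = (\<lambda>x. h f x + h g x)"
    and id: "h id = id"
    using assms by (auto simp: ring_iso_def ring_hom_def endo_ring_ops)
  note auto = orthoposet_automorphism_of_ring_map[OF bij add id]
  have mem: "h p \<in> \<P>" if "p \<in> \<P>" for p
    by (rule auto(2)) (use that mult in blast)+
  have poset: "orthoposet_automorphism \<P> (restrict h \<P>)"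
    by (rule auto(1)) (use mult in blast)+
  have "range (restrict h \<P> p) = range (restrict h \<P> q)"
    if p: "p \<in> \<P>" and q: "q \<in> \<P>" and r: "range p = range q" for p q
  proof -
    have "h p \<circ> h q = h q \<and> h q \<circ> h p = h p"
      using range_eq_iff[OF p q] r mult projectionD(1) p q by metis
    then show ?thesis
      using p q range_eq_iff[OF mem[OF p] mem[OF q]] by simp
  qed
  with poset show ?thesis
    unfolding even_automorphism_def by blast
qed

lemma odd_automorphism_of_anti_automorphism:
  assumes "h \<in> ring_anti_automorphisms \<R>"
  shows "odd_automorphism \<P> (restrict h \<P>)"
proof -
  have bij: "bij_betw h (carrier \<R>) (carrier \<R>)"
    and mult: "\<And>f g. f \<in> carrier \<R> \<Longrightarrow> g \<in> carrier \<R> \<Longrightarrow> h (f \<circ> g) = h g \<circ> h f"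
    and add: "\<And>f g. f \<in> carrier \<R> \<Longrightarrow> g \<in> carrier \<R> \<Longrightarrow>
        h (\<lambda>x. f x + g x) = (\<lambda>x. h f x + h g x)"
    using assms by (auto simp: ring_anti_automorphisms_def endo_ring_ops)
  have id: "h id = id"
  proof -
    have i: "id \<in> carrier \<R>"
      by (rule endo_if_adjoint[where g = id]) simp
    then obtain f where "f \<in> carrier \<R>" "h f = id"
      using bij unfolding bij_betw_def by (metis imageE)
    then show ?thesis
      using mult[of id f] i by simp
  qed
  note auto = orthoposet_automorphism_of_ring_map[OF bij add id]
  have mem: "h p \<in> \<P>" if "p \<in> \<P>" for p
    by (rule auto(2)) (use that mult in blast)+
  have poset: "orthoposet_automorphism \<P> (restrict h \<P>)"
    by (rule auto(1)) (use mult in blast)+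
  have "kernel_of (restrict h \<P> p) = kernel_of (restrict h \<P> q)"
    if p: "p \<in> \<P>" and q: "q \<in> \<P>" and r: "range p = range q" for p q
  proof -
    have "h p \<circ> h q = h p" "h q \<circ> h p = h q"
      using range_eq_iff[OF p q] r mult projectionD(1) p q by metis+
    then show ?thesis
      using p q kernel_eq_if[OF mem[OF p] mem[OF q]] by simp
  qed
  with poset show ?thesis
    unfolding odd_automorphism_def by blast
qed

end

section \<open>Dimension\<close>

context left_vector_space
begin

lemma in_left_span_finite:
  assumes "finite S"
  shows "w \<in> left_span lscale S \<longleftrightarrow> (\<exists>c. w = (\<Sum>v\<in>S. lscale (c v) v))"
proof
  assume "w \<in> left_span lscale S"
  then obtain T c where T: "T \<subseteq> S" "w = (\<Sum>v\<in>T. lscale (c v) v)"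
    unfolding left_span_def by blast
  have "w = (\<Sum>v\<in>S. lscale (if v \<in> T then c v else 0) v)"
    unfolding T(2) by (rule sum.mono_neutral_cong_left) (use assms T in \<open>auto simp: scale_zero_left\<close>)
  then show "\<exists>c. w = (\<Sum>v\<in>S. lscale (c v) v)"
    by metis
qed (use assms in \<open>auto simp: left_span_def\<close>)

lemma left_span_remove_dependent:
  assumes S: "finite S" "left_span lscale S = UNIV" and dep: "\<not> left_independent lscale S"
  obtains v where "v \<in> S" "left_span lscale (S - {v}) = UNIV"
proof -
  obtain T c v where T: "T \<subseteq> S" "(\<Sum>t\<in>T. lscale (c t) t) = 0" and v: "v \<in> T" "c v \<noteq> 0"
    using dep unfolding left_independent_def by blast
  define k where "k t = - inverse (c v) * (if t \<in> T then c t else 0)" for t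
  have fin: "finite (S - {v})"
    using S(1) by blast
  have "(\<Sum>t\<in>S. lscale (if t \<in> T then c t else 0) t) = (\<Sum>t\<in>T. lscale (c t) t)"
    by (rule sum.mono_neutral_cong_right) (use S(1) T in \<open>auto simp: scale_zero_left\<close>)
  then have "lscale (c v) v + (\<Sum>t\<in>S - {v}. lscale (if t \<in> T then c t else 0) t) = 0"
    using T v S(1) by (subst (asm) sum.remove[of S v]) auto
  then have "lscale (inverse (c v))
      (lscale (c v) v + (\<Sum>t\<in>S - {v}. lscale (if t \<in> T then c t else 0) t)) = 0"
    by (simp add: scale_zero_right)
  then have v_eq: "v = (\<Sum>t\<in>S - {v}. lscale (k t) t)"
    using v(2) by (simp add: lscale_add_right scale_inverse scale_sum lscale_lscale k_def lscale_one
        scale_minus_left sum_negf eq_neg_iff_add_eq_0)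
  have "w \<in> left_span lscale (S - {v})" for w
  proof -
    obtain d where "w = (\<Sum>t\<in>S. lscale (d t) t)"
      using S in_left_span_finite by blast
    also have "\<dots> = lscale (d v) v + (\<Sum>t\<in>S - {v}. lscale (d t) t)"
      using S(1) T(1) v(1) by (subst sum.remove[of S v]) auto
    also have "lscale (d v) v = (\<Sum>t\<in>S - {v}. lscale (d v * k t) t)"
      using v_eq scale_sum[of "d v" "\<lambda>t. lscale (k t) t" "S - {v}"] by (simp add: lscale_lscale)
    finally have "w = (\<Sum>t\<in>S - {v}. lscale (d v * k t + d t) t)"
      by (simp add: sum.distrib lscale_add_left)
    then show ?thesis
      using in_left_span_finite[OF fin] by metis
  qed
  then show thesis
    using that T(1) v(1) by blast
qed

text \<open>Needed because \<^term>\<open>left_dim\<close> is infinite as soon as there is no finite basis: that this does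
  not happen for a space spanned by two vectors has to be shown.\<close>

lemma finite_basis_exists:
  assumes "finite S" "left_span lscale S = UNIV"
  shows "\<exists>T. finite T \<and> left_basis lscale T"
  using assms
proof (induction S rule: finite_psubset_induct)
  case (psubset S)
  show ?case
  proof (cases "left_independent lscale S")
    case True
    then show ?thesis
      using psubset by (auto simp: left_basis_def)
  next
    case False
    then obtain v where "v \<in> S" "left_span lscale (S - {v}) = UNIV"
      using psubset left_span_remove_dependent by metis
    then show ?thesis
      using psubset.IH[of "S - {v}"] by blast
  qed
qed

text \<open>The exchange step: solve the equation of \<open>z\<close> for \<open>v\<close>.\<close>

lemma plane_exchange:
  assumes "\<And>w. \<exists>a b. w = lscale a u + lscale b v" "z = lscale a u + lscale b v" "b \<noteq> 0"
  shows "\<exists>a b. w = lscale a u + lscale b z"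
proof -
  obtain c d where w: "w = lscale c u + lscale d v"
    using assms(1) by blast
  have "w = lscale (c - d * inverse b * a) u + lscale (d * inverse b) z"
    using assms(3) by (simp add: w assms(2) scale_simps mult.assoc)
  then show ?thesis
    by blast
qed

text \<open>If \<open>u\<close> and \<open>v\<close> spanned everything, \<open>x\<close> could be exchanged for one of them and \<open>y\<close> for the
  other, and \<open>z\<close> would be a combination of \<open>x\<close> and \<open>y\<close>.\<close>

lemma independent_triple_not_in_plane:
  assumes ind: "left_independent lscale {x, y, z}" and ne: "x \<noteq> y" "x \<noteq> z" "y \<noteq> z"
  shows "\<exists>w. \<forall>a b. w \<noteq> lscale a u + lscale b v"
proof (rule ccontr)
  assume "\<not> ?thesis"
  then have span: "\<exists>a b. w = lscale a u + lscale b v" for w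
    by blast
  have triple: "a = 0 \<and> b = 0 \<and> c = 0" if "lscale a x + lscale b y + lscale c z = 0" for a b c
  proof -
    define k where "k = (\<lambda>_. c)(x := a, y := b)"
    have "(\<Sum>t\<in>{x, y, z}. lscale (k t) t) = 0"
      using that ne by (simp add: k_def add.assoc)
    then have "\<forall>t\<in>{x, y, z}. k t = 0"
      using ind[unfolded left_independent_def, rule_format, of "{x, y, z}" k] by simp
    then show ?thesis
      using ne by (simp add: k_def)
  qed
  obtain a b where x: "x = lscale a u + lscale b v"
    using span by blast
  have "\<exists>u'. \<forall>w. \<exists>a b. w = lscale a u' + lscale b x"
  proof (cases "b = 0")
    case False
    then show ?thesis
      using plane_exchange[OF span x] by blast
  next
    case True
    have "a \<noteq> 0"
      using triple[of 1 0 0] x True by (auto simp: scale_simps)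
    moreover have "\<exists>a b. w = lscale a v + lscale b u" for w
      using span[of w] by (metis add.commute)
    moreover have "x = lscale b v + lscale a u"
      using x by (simp add: add.commute)
    ultimately show ?thesis
      using plane_exchange[of v u x b a] by blast
  qed
  then obtain u' where u': "\<And>w. \<exists>a b. w = lscale a u' + lscale b x"
    by blast
  then obtain c d where y: "y = lscale c u' + lscale d x"
    by blast
  have "c \<noteq> 0"
    using triple[of d "-1" 0] y by (auto simp: scale_simps)
  moreover have "\<exists>a b. w = lscale a x + lscale b u'" for w
    using u'[of w] by (metis add.commute)
  moreover have "y = lscale d x + lscale c u'"
    using y by (simp add: add.commute)
  ultimately obtain p q where "z = lscale p x + lscale q y"
    using plane_exchange[of x u' y d c z] by blast
  then show False
    using triple[of p q "-1"] by (simp add: scale_simps)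
qed

lemma not_in_plane_if_dim:
  assumes "left_dim lscale \<ge> 3"
  shows "\<exists>w. \<forall>a b. w \<noteq> lscale a u + lscale b v"
proof (rule ccontr)
  assume no: "\<not> ?thesis"
  have "w \<in> left_span lscale {u, v}" for w
  proof -
    obtain a b where w: "w = lscale a u + lscale b v"
      using no by blast
    show ?thesis
    proof (cases "u = v")
      case True
      then have "w = (\<Sum>t\<in>{u, v}. lscale (a + b) t)"
        by (simp add: w lscale_add_left)
      then show ?thesis
        by (intro in_left_span_finite[THEN iffD2] exI[of _ "\<lambda>_. a + b"]) simp
    next
      case False
      then have "w = (\<Sum>t\<in>{u, v}. lscale (if t = u then a else b) t)"
        by (simp add: w)
      then show ?thesis
        by (intro in_left_span_finite[THEN iffD2] exI[of _ "\<lambda>t. if t = u then a else b"]) simp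
    qed
  qed
  then have ex: "\<exists>B. finite B \<and> left_basis lscale B"
    using finite_basis_exists[of "{u, v}"] by blast
  define B where "B = (SOME B. finite B \<and> left_basis lscale B)"
  have B: "finite B" "left_basis lscale B"
    using someI_ex[OF ex] unfolding B_def by auto
  have "3 \<le> card B"
    using assms ex by (simp add: left_dim_def B_def numeral_eq_enat)
  then obtain T where T: "T \<subseteq> B" "card T = 3"
    by (meson obtain_subset_with_card_n)
  then obtain x y z where xyz: "T = {x, y, z}" "x \<noteq> y" "x \<noteq> z" "y \<noteq> z"
    by (auto simp: card_3_iff)
  have "left_independent lscale {x, y, z}"
    using B(2) T(1) unfolding left_basis_def left_independent_def xyz(1) by (meson subset_trans)
  then show False
    using independent_triple_not_in_plane xyz no by blast
qed

end

section \<open>The fundamental theorem of projective geometry\<close>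

text \<open>A map between the lines of \<open>F\<close>, given by representatives \<open>B y\<close>, such that for each line of \<open>E\<close>
  some line has the corresponding orthogonality relations, and conversely.  The last assumption is
  the condition on the dimension that makes the action on lines semilinear.\<close>

locale orthogonality_correspondence = dual_pair lscale rscale \<beta>
  for lscale :: "'k::division_ring \<Rightarrow> 'e::ab_group_add \<Rightarrow> 'e"
    and rscale :: "'f::ab_group_add \<Rightarrow> 'k \<Rightarrow> 'f"
    and \<beta> :: "'e \<Rightarrow> 'f \<Rightarrow> 'k" +
  fixes B :: "'f \<Rightarrow> 'f"
  assumes onto_lines: "\<exists>y a. y' = rscale (B y) a"
    and image_exists: "\<exists>w. \<forall>y. \<beta> w (B y) = 0 \<longleftrightarrow> \<beta> v y = 0"
    and preimage_exists: "\<exists>v. \<forall>y. \<beta> w (B y) = 0 \<longleftrightarrow> \<beta> v y = 0"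
    and not_plane: "\<exists>w. \<forall>a b. w \<noteq> lscale a u + lscale b v"
begin

text \<open>The action on lines of \<open>E\<close>, as a relation between vectors: \<open>Kv\<close> is mapped to \<open>Kw\<close>.  It is
  determined by the map \<open>B\<close> on \<open>F\<close> and relates \<open>0\<close> to \<open>0\<close> only, which avoids both quotients
  and case distinctions.\<close>

definition corresponds :: "'e \<Rightarrow> 'e \<Rightarrow> bool" where
  "corresponds v w \<longleftrightarrow> (\<forall>y. \<beta> w (B y) = 0 \<longleftrightarrow> \<beta> v y = 0)"

lemma corresponds_zero: "corresponds 0 0"
  by (simp add: corresponds_def form_zero)

lemma corresponds_zero_left:
  assumes "corresponds 0 w"
  shows "w = 0"
proof (rule nondegenerate_left)
  fix y'
  obtain y a where "y' = rscale (B y) a"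
    using onto_lines by blast
  then show "\<beta> w y' = 0"
    using assms by (simp add: corresponds_def form_zero form_rscale)
qed

lemma corresponds_zero_right: "corresponds v 0 \<Longrightarrow> v = 0"
  using nondegenerate_left by (simp add: corresponds_def form_zero)

lemma corresponds_scale_left: "corresponds v w \<Longrightarrow> a \<noteq> 0 \<Longrightarrow> corresponds (lscale a v) w"
  by (simp add: corresponds_def form_lscale)

lemma corresponds_scale_right: "corresponds v w \<Longrightarrow> a \<noteq> 0 \<Longrightarrow> corresponds v (lscale a w)"
  by (simp add: corresponds_def form_lscale)

text \<open>Collinearity is preserved because a plane of \<open>E\<close> consists of the vectors orthogonal to
  all \<open>y\<close> that are orthogonal to two spanning vectors.\<close>

lemma corresponds_plane:
  assumes "corresponds u u'" "corresponds v v'" "corresponds w w'"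
    and "w = lscale a u + lscale b v"
  shows "\<exists>a b. w' = lscale a u' + lscale b v'"
proof (rule in_plane_if_perp)
  fix y' assume y': "\<beta> u' y' = 0" "\<beta> v' y' = 0"
  obtain y c where c: "y' = rscale (B y) c"
    using onto_lines by blast
  show "\<beta> w' y' = 0"
  proof (cases "c = 0")
    case False
    then have "\<beta> u y = 0" "\<beta> v y = 0"
      using assms y' by (simp_all add: corresponds_def c form_rscale)
    then have "\<beta> w y = 0"
      by (simp add: assms(4) form_simps)
    then show ?thesis
      using assms(3) by (simp add: corresponds_def c form_rscale)
  qed (simp add: c form_rscale)
qed

lemma corresponds_unique_right:
  assumes "corresponds v w" "corresponds v w'"
  shows "\<exists>a. w' = lscale a w"
  using corresponds_plane[OF assms(1) corresponds_zero assms(2), of 1 0]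
  by (simp add: scale_simps)

lemma corresponds_unique_left:
  assumes "corresponds v w" "corresponds v' w"
  shows "\<exists>a. v' = lscale a v"
  by (rule in_line_if_perp) (use assms in \<open>simp add: corresponds_def\<close>)

end

text \<open>The hyperplane \<open>y0\<^sup>\<bottom>\<close> plays the hyperplane at infinity and \<open>e\<close> the origin; the primed data are
  their images, scaled such that \<open>e'\<close> again has height \<open>1\<close>.\<close>

locale affine_chart = orthogonality_correspondence lscale rscale \<beta> B
  for lscale :: "'k::division_ring \<Rightarrow> 'e::ab_group_add \<Rightarrow> 'e"
    and rscale :: "'f::ab_group_add \<Rightarrow> 'k \<Rightarrow> 'f"
    and \<beta> :: "'e \<Rightarrow> 'f \<Rightarrow> 'k"
    and B :: "'f \<Rightarrow> 'f" +
  fixes e e' :: 'e and y0 y0' :: 'f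
  assumes origin: "\<beta> e y0 = 1" "\<beta> e' y0' = 1" "corresponds e e'"
    and hyperplane: "\<beta> w y0' = 0 \<longleftrightarrow> \<beta> w (B y0) = 0"
begin

lemma corresponds_hyperplane: "corresponds v w \<Longrightarrow> \<beta> w y0' = 0 \<longleftrightarrow> \<beta> v y0 = 0"
  by (simp add: corresponds_def hyperplane)

text \<open>The map \<open>s\<close> that describes the action on the affine points \<open>e + x\<close>, with \<open>x\<close> in the hyperplane.\<close>

definition displacement :: "'e \<Rightarrow> 'e" where
  "displacement x = (THE w. \<beta> w y0' = 0 \<and> corresponds (e + x) (e' + w))"

lemma displacement_unique:
  assumes "\<beta> w y0' = 0" "corresponds (e + x) (e' + w)"
  shows "displacement x = w"
  unfolding displacement_def
proof (rule the_equality)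
  fix w' assume w': "\<beta> w' y0' = 0 \<and> corresponds (e + x) (e' + w')"
  then obtain a where a: "e' + w' = lscale a (e' + w)"
    using corresponds_unique_right assms(2) by blast
  have "\<beta> (e' + w') y0' = a * \<beta> (e' + w) y0'"
    by (simp only: a form_lscale)
  then have "a = 1"
    using w' assms(1) origin by (simp add: form_add_left)
  then show "w' = w"
    using a by (simp add: lscale_one)
qed (use assms in blast)

lemma displacement:
  assumes "\<beta> x y0 = 0"
  shows "\<beta> (displacement x) y0' = 0" "corresponds (e + x) (e' + displacement x)"
proof -
  obtain w where w: "corresponds (e + x) w"
    using image_exists unfolding corresponds_def by blast
  define a where "a = inverse (\<beta> w y0')"
  have "\<beta> w y0' \<noteq> 0"
    using corresponds_hyperplane[OF w] assms origin by (simp add: form_add_left)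
  then have "\<beta> (lscale a w - e') y0' = 0" "corresponds (e + x) (e' + (lscale a w - e'))"
    using corresponds_scale_right[OF w, of a] by (simp_all add: form_simps origin a_def)
  then show "\<beta> (displacement x) y0' = 0" "corresponds (e + x) (e' + displacement x)"
    using displacement_unique by simp_all
qed

lemma displacement_onto:
  assumes "\<beta> w y0' = 0"
  obtains x where "\<beta> x y0 = 0" "displacement x = w"
proof -
  obtain v where v: "corresponds v (e' + w)"
    using preimage_exists unfolding corresponds_def by blast
  define a where "a = inverse (\<beta> v y0)"
  have "\<beta> v y0 \<noteq> 0"
    using corresponds_hyperplane[OF v] assms origin by (simp add: form_add_left)
  then have "\<beta> (lscale a v - e) y0 = 0" "corresponds (e + (lscale a v - e)) (e' + w)"
    using corresponds_scale_left[OF v, of a] by (simp_all add: form_simps origin a_def)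
  then show thesis
    using that displacement_unique[OF assms] by blast
qed

lemma displacement_zero: "displacement 0 = 0"
  by (rule displacement_unique) (simp_all add: form_zero origin)

text \<open>The line of \<open>x - z\<close> is the intersection of the hyperplane with the plane of \<open>e + x\<close> and
  \<open>e + z\<close>.  So its image lies in the plane of \<open>e' + s(x)\<close> and \<open>e' + s(z)\<close>, and lying in the
  hyperplane of \<open>y0'\<close> it is spanned by \<open>s(x) - s(z)\<close>.\<close>

lemma corresponds_displacement_diff:
  assumes x: "\<beta> x y0 = 0" and z: "\<beta> z y0 = 0"
  shows "corresponds (x - z) (displacement x - displacement z)"
proof (cases "x = z")
  case True
  then show ?thesis
    by (simp add: corresponds_zero)
next
  case False
  obtain w where w: "corresponds (x - z) w"
    using image_exists unfolding corresponds_def by blast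
  have "x - z = lscale 1 (e + x) + lscale (- 1) (e + z)"
    by (simp add: scale_simps)
  then obtain a b where ab: "w = lscale a (e' + displacement x) + lscale b (e' + displacement z)"
    using corresponds_plane[OF displacement(2)[OF x] displacement(2)[OF z] w] by blast
  have "\<beta> w y0' = 0"
    using corresponds_hyperplane[OF w] x z by (simp add: form_diff_left)
  then have "a + b = 0"
    using displacement(1)[OF x] displacement(1)[OF z] origin by (simp add: ab form_simps)
  then have "b = - a"
    by (simp add: eq_neg_iff_add_eq_0 add.commute)
  then have w_eq: "w = lscale a (displacement x - displacement z)"
    by (simp add: ab scale_simps)
  have "a \<noteq> 0"
    using w w_eq corresponds_zero_right False scale_zero_left by fastforce
  then show ?thesis
    using corresponds_scale_right[OF w, of "inverse a"] by (simp add: w_eq scale_inverse)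
qed

lemma corresponds_displacement: "\<beta> x y0 = 0 \<Longrightarrow> corresponds x (displacement x)"
  using corresponds_displacement_diff[of x 0] by (simp add: form_zero displacement_zero)

lemma displacement_reflects_line:
  assumes "\<beta> x y0 = 0" "\<beta> z y0 = 0" "displacement z = lscale a (displacement x)"
  shows "\<exists>b. z = lscale b x"
proof (cases "a = 0")
  case True
  then have "z = 0"
    using corresponds_displacement[OF assms(2)] assms(3) corresponds_zero_right
    by (simp add: scale_zero_left)
  then show ?thesis
    using scale_zero_left by metis
next
  case False
  then have "corresponds x (displacement z)"
    using assms corresponds_displacement corresponds_scale_right by simp
  then show ?thesis
    using corresponds_unique_left corresponds_displacement[OF assms(2)] by blast
qed

lemma outside_line:
  obtains w where "\<beta> w y0 = 0" "\<And>a. w \<noteq> lscale a x"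
proof -
  obtain v where v: "\<And>a b. v \<noteq> lscale a x + lscale b e"
    using not_plane by blast
  have "v - lscale (\<beta> v y0) e \<noteq> lscale a x" for a
    using v[of a "\<beta> v y0"] by (simp add: diff_eq_eq)
  then show thesis
    using that[of "v - lscale (\<beta> v y0) e"] origin by (simp add: form_simps)
qed

text \<open>The fourth vertex of the parallelogram on \<open>0\<close>, \<open>x\<close>, \<open>z\<close>: by \<open>corresponds_displacement_diff\<close>,
  \<open>s(x + z)\<close> lies on the parallel to \<open>s(z)\<close> through \<open>s(x)\<close> and on the parallel to \<open>s(x)\<close>
  through \<open>s(z)\<close>.\<close>

lemma displacement_add_independent:
  assumes x: "\<beta> x y0 = 0" and z: "\<beta> z y0 = 0" and indep: "\<And>a. z \<noteq> lscale a x"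
  shows "displacement (x + z) = displacement x + displacement z"
proof -
  let ?s = displacement
  have xz: "\<beta> (x + z) y0 = 0"
    using x z by (simp add: form_add_left)
  have "corresponds z (?s (x + z) - ?s x)" "corresponds x (?s (x + z) - ?s z)"
    using corresponds_displacement_diff[OF xz x] corresponds_displacement_diff[OF xz z] by simp_all
  then obtain c d where c: "?s (x + z) - ?s x = lscale c (?s z)"
      and d: "?s (x + z) - ?s z = lscale d (?s x)"
    using corresponds_unique_right corresponds_displacement x z by meson
  \<comment> \<open>the two expressions for \<open>s(x + z)\<close>; were \<open>c \<noteq> 1\<close>, then \<open>s(z)\<close> would be a multiple of \<open>s(x)\<close>\<close>
  have "lscale (1 - c) (?s z) = lscale (1 - d) (?s x)"
    using c d by (simp add: scale_simps algebra_simps)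
  then have "c = 1"
    using eq_scale_of_scale_eq displacement_reflects_line[OF x z] indep
    by (metis right_minus_eq)
  then show ?thesis
    using c by (simp add: lscale_one algebra_simps)
qed

text \<open>For dependent \<open>x\<close> and \<open>z\<close>, compute \<open>s(x + z + w)\<close> in two ways with \<open>w\<close> outside their line.\<close>

lemma displacement_add:
  assumes x: "\<beta> x y0 = 0" and z: "\<beta> z y0 = 0"
  shows "displacement (x + z) = displacement x + displacement z"
proof (cases "\<forall>a. z \<noteq> lscale a x")
  case True
  then show ?thesis
    using displacement_add_independent[OF x z] by blast
next
  case False
  then obtain a where a: "z = lscale a x"
    by blast
  obtain w where w: "\<beta> w y0 = 0" and indep: "\<And>a. w \<noteq> lscale a x"
    using outside_line by blast
  have "z + w \<noteq> lscale b x" for b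
    using indep[of "b - a"] by (auto simp: a scale_diff_left algebra_simps)
  then have "displacement (x + (z + w)) = displacement x + displacement (z + w)"
    using x z w by (intro displacement_add_independent) (simp_all add: form_add_left)
  moreover have "w \<noteq> lscale b z" for b
    using indep[of "b * a"] by (simp add: a lscale_lscale)
  then have "displacement (z + w) = displacement z + displacement w"
    using z w by (intro displacement_add_independent) simp_all
  moreover have "w \<noteq> lscale b (x + z)" for b
    using indep[of "b + b * a"] by (simp add: a scale_simps)
  then have "displacement ((x + z) + w) = displacement (x + z) + displacement w"
    using x z w by (intro displacement_add_independent) (simp_all add: form_add_left)
  ultimately show ?thesis
    by (simp add: add.assoc [symmetric])
qed

lemma displacement_scale_in_line:
  assumes x: "\<beta> x y0 = 0"
  shows "\<exists>b. displacement (lscale a x) = lscale b (displacement x)"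
proof (cases "a = 0")
  case True
  then show ?thesis
    by (metis displacement_zero scale_zero_left)
next
  case False
  have "corresponds (lscale a x) (displacement (lscale a x))"
    using x by (intro corresponds_displacement) (simp add: form_lscale)
  moreover have "corresponds (lscale a x) (displacement x)"
    using corresponds_scale_left[OF corresponds_displacement[OF x] False] .
  ultimately show ?thesis
    using corresponds_unique_right by blast
qed

text \<open>The factor by which \<open>s\<close> stretches \<open>ax\<close> agrees with the one for \<open>au\<close>, as both agree with
  the one for \<open>a(u + x)\<close>.\<close>

lemma displacement_scale_independent:
  assumes u: "\<beta> u y0 = 0" "u \<noteq> 0" and x: "\<beta> x y0 = 0" and indep: "\<And>a. x \<noteq> lscale a u"
    and b: "displacement (lscale a u) = lscale b (displacement u)"
  shows "displacement (lscale a x) = lscale b (displacement x)"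
proof -
  let ?s = displacement
  obtain c where "?s (lscale a (u + x)) = lscale c (?s (u + x))"
    using displacement_scale_in_line[of "u + x" a] u x by (auto simp: form_add_left)
  moreover obtain d where d: "?s (lscale a x) = lscale d (?s x)"
    using displacement_scale_in_line[OF x] by blast
  \<comment> \<open>from \<open>c s(u) + c s(x) = b s(u) + d s(x)\<close>\<close>
  ultimately have *: "lscale (d - c) (?s x) = lscale (c - b) (?s u)"
    using u x b by (simp add: scale_simps displacement_add form_lscale algebra_simps)
  then have "d = c"
    using eq_scale_of_scale_eq displacement_reflects_line[OF u(1) x] indep
    by (metis right_minus_eq)
  moreover have "?s u \<noteq> 0"
    using corresponds_displacement[OF u(1)] corresponds_zero_right u(2) by metis
  ultimately show ?thesis
    using * d by (simp add: scale_eq_0_iff scale_zero_left)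
qed

text \<open>The factor \<open>\<sigma>\<close> is read off from one vector \<open>u\<close> of the hyperplane; for a multiple \<open>x\<close> of \<open>u\<close>
  the equation follows from those for \<open>w\<close> and \<open>x + w\<close> with \<open>w\<close> outside the line of \<open>u\<close>.  It is onto
  because the displacement maps the line of \<open>u\<close> onto the line of its image.\<close>

lemma displacement_semilinear:
  obtains \<sigma> where "\<And>a x. \<beta> x y0 = 0 \<Longrightarrow> displacement (lscale a x) = lscale (\<sigma> a) (displacement x)"
    "\<And>a b. \<sigma> (a + b) = \<sigma> a + \<sigma> b" "\<And>a b. \<sigma> (a * b) = \<sigma> a * \<sigma> b"
    "\<And>a. \<sigma> a = 0 \<longleftrightarrow> a = 0" "surj \<sigma>"
proof -
  let ?s = displacement
  obtain u where u: "\<beta> u y0 = 0" and u_ne: "u \<noteq> 0"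
    using outside_line[of 0] scale_zero_left by metis
  have su: "?s u \<noteq> 0"
    using corresponds_displacement[OF u] corresponds_zero_right u_ne by metis
  obtain \<sigma> where \<sigma>: "\<And>a. ?s (lscale a u) = lscale (\<sigma> a) (?s u)"
    using displacement_scale_in_line[OF u] by metis
  have scale: "?s (lscale a x) = lscale (\<sigma> a) (?s x)" if x: "\<beta> x y0 = 0" for a x
  proof (cases "\<forall>c. x \<noteq> lscale c u")
    case True
    then show ?thesis
      using displacement_scale_independent[OF u u_ne x _ \<sigma>] by blast
  next
    case False
    then obtain c where c: "x = lscale c u"
      by blast
    obtain w where w: "\<beta> w y0 = 0" and indep: "\<And>a. w \<noteq> lscale a u"
      using outside_line by blast
    have indep': "x + w \<noteq> lscale b u" for b
      using indep[of "b - c"] by (auto simp: c scale_diff_left algebra_simps)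
    have "?s (lscale a (x + w)) = lscale (\<sigma> a) (?s (x + w))"
      using x w by (intro displacement_scale_independent[OF u u_ne _ indep' \<sigma>]) (simp add: form_add_left)
    moreover have "?s (lscale a w) = lscale (\<sigma> a) (?s w)"
      using displacement_scale_independent[OF u u_ne w indep \<sigma>] .
    ultimately show ?thesis
      using x w by (simp add: lscale_add_right displacement_add form_lscale)
  qed
  have cancel: "a = b" if "lscale a (?s u) = lscale b (?s u)" for a b
    using that su scale_eq_0_iff[of "a - b" "?s u"] by (simp add: scale_diff_left)
  have "\<sigma> (a + b) = \<sigma> a + \<sigma> b" for a b
    using u by (intro cancel) (simp add: \<sigma>[symmetric] lscale_add_left displacement_add form_lscale)
  moreover have "\<sigma> (a * b) = \<sigma> a * \<sigma> b" for a b
  proof (rule cancel)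
    have "lscale (\<sigma> (a * b)) (?s u) = ?s (lscale a (lscale b u))"
      by (simp add: \<sigma>[symmetric] lscale_lscale)
    also have "\<dots> = lscale (\<sigma> a) (lscale (\<sigma> b) (?s u))"
      using u scale[of "lscale b u" a] by (simp add: form_lscale \<sigma>)
    finally show "lscale (\<sigma> (a * b)) (?s u) = lscale (\<sigma> a * \<sigma> b) (?s u)"
      by (simp add: lscale_lscale)
  qed
  moreover have "\<sigma> a = 0 \<longleftrightarrow> a = 0" for a
  proof
    assume "a = 0"
    then show "\<sigma> a = 0"
      using \<sigma>[of 0] su by (simp add: scale_zero_left displacement_zero scale_eq_0_iff)
  next
    assume "\<sigma> a = 0"
    then have "?s (lscale a u) = 0"
      by (simp add: \<sigma> scale_zero_left)
    moreover have "corresponds (lscale a u) (?s (lscale a u))"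
      using u by (intro corresponds_displacement) (simp add: form_lscale)
    ultimately have "lscale a u = 0"
      using corresponds_zero_right by metis
    then show "a = 0"
      using u_ne by (simp add: scale_eq_0_iff)
  qed
  moreover have "\<exists>a. b = \<sigma> a" for b
  proof -
    obtain x where x: "\<beta> x y0 = 0" "?s x = lscale b (?s u)"
      using displacement_onto[of "lscale b (?s u)"] displacement(1)[OF u]
      by (auto simp: form_lscale)
    then obtain a where "x = lscale a u"
      using displacement_reflects_line[OF u] by blast
    then have "b = \<sigma> a"
      using x \<sigma> by (intro cancel) simp
    then show ?thesis ..
  qed
  then have "surj \<sigma>"
    by (auto simp: surj_def)
  ultimately show thesis
    using that scale by blast
qed

end

context orthogonality_correspondence
begin

text \<open>Every \<open>v\<close> is \<open>\<beta>(v,y0)e\<close> plus an element of the hyperplane, called \<open>flat v\<close> below; \<open>S\<close> is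
  \<open>\<sigma>\<close> on the first summand and the displacement on the second.\<close>

theorem semilinear_bijection_exists:
  obtains S \<sigma> where "\<And>v w. S (v + w) = S v + S w" "\<And>a v. S (lscale a v) = lscale (\<sigma> a) (S v)"
    "bij S" "surj \<sigma>" "\<And>v. corresponds v (S v)"
proof -
  obtain e :: 'e where "e \<noteq> 0"
    using not_plane[of 0 0] by (metis add_0 scale_zero_right)
  then obtain y0 where e: "\<beta> e y0 = 1"
    by (rule unit_functional)
  obtain e' where e': "corresponds e e'"
    using image_exists unfolding corresponds_def by blast
  define c where "c = \<beta> e' (B y0)"
  \<comment> \<open>scaled to make \<open>\<beta>(e', y0') = 1\<close>; this does not change the hyperplane\<close>
  define y0' where "y0' = rscale (B y0) (inverse c)"
  have c: "c \<noteq> 0"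
    using e e' unfolding c_def corresponds_def by (metis zero_neq_one)
  interpret affine_chart lscale rscale \<beta> B e e' y0 y0'
    by unfold_locales (use c e e' in \<open>simp_all add: y0'_def form_rscale flip: c_def\<close>)
  let ?s = displacement
  obtain \<sigma> where s_scale: "\<And>a x. \<beta> x y0 = 0 \<Longrightarrow> ?s (lscale a x) = lscale (\<sigma> a) (?s x)"
    and \<sigma>: "\<And>a b. \<sigma> (a + b) = \<sigma> a + \<sigma> b" "\<And>a b. \<sigma> (a * b) = \<sigma> a * \<sigma> b"
      "\<And>a. \<sigma> a = 0 \<longleftrightarrow> a = 0" "surj \<sigma>"
    using displacement_semilinear by metis
  define flat where "flat v = v - lscale (\<beta> v y0) e" for v
  define S where "S v = lscale (\<sigma> (\<beta> v y0)) e' + ?s (flat v)" for v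
  have flat: "\<beta> (flat v) y0 = 0" for v
    by (simp add: flat_def form_simps e)
  have S_add: "S (v + w) = S v + S w" for v w
  proof -
    have "flat (v + w) = flat v + flat w"
      by (simp add: flat_def form_simps scale_simps)
    then show ?thesis
      by (simp add: S_def displacement_add flat form_add_left \<sigma> lscale_add_left)
  qed
  have S_scale: "S (lscale a v) = lscale (\<sigma> a) (S v)" for a v
  proof -
    have "flat (lscale a v) = lscale a (flat v)"
      by (simp add: flat_def form_simps scale_simps)
    then show ?thesis
      by (simp add: S_def s_scale flat form_lscale \<sigma> scale_simps)
  qed
  have S_corr: "corresponds v (S v)" for v
  proof (cases "\<beta> v y0 = 0")
    case True
    moreover have "\<sigma> 0 = 0"
      using \<sigma>(3)[of 0] by simp
    ultimately have "S v = ?s v"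
      by (simp add: S_def flat_def scale_simps)
    then show ?thesis
      using corresponds_displacement[OF True] by simp
  next
    case False
    define a where "a = \<beta> v y0"
    define x where "x = flat (lscale (inverse a) v)"
    have a: "a \<noteq> 0"
      using False by (simp add: a_def)
    have ex: "lscale (inverse a) v = e + x"
      using a by (simp add: x_def flat_def form_simps lscale_one flip: a_def)
    have v: "v = lscale a (e + x)"
      using a by (simp add: lscale_lscale lscale_one flip: ex)
    have x: "\<beta> x y0 = 0"
      by (simp add: x_def flat)
    have "\<sigma> 1 = 1"
      using \<sigma>(2)[of 1 1] \<sigma>(3)[of 1] by simp
    then have "S (e + x) = e' + ?s x"
      by (simp add: S_def flat_def form_simps x e lscale_one)
    then have "corresponds v (lscale (\<sigma> a) (e' + ?s x))"
      unfolding v using a \<sigma>(3) displacement(2)[OF x]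
      by (intro corresponds_scale_left corresponds_scale_right) auto
    then show ?thesis
      by (simp add: v S_scale \<open>S (e + x) = e' + ?s x\<close>)
  qed
  have "\<exists>v. w = S v" for w
  proof -
    obtain a where a: "\<beta> w y0' = \<sigma> a"
      using \<sigma>(4) by (metis surjE)
    have "\<beta> (w - lscale (\<sigma> a) e') y0' = 0"
      using origin by (simp add: form_simps a)
    then obtain x where x: "\<beta> x y0 = 0" "?s x = w - lscale (\<sigma> a) e'"
      by (rule displacement_onto)
    have "S (lscale a e + x) = w"
      by (simp add: S_def flat_def form_simps x e)
    then show ?thesis
      by metis
  qed
  then have "surj S"
    by (auto simp: surj_def)
  moreover have "inj S"
  proof (rule injI)
    fix v w assume "S v = S w"
    then have "S (v - w) = 0"
      using S_add[of "v - w" w] by simp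
    then have "v - w = 0"
      using S_corr[of "v - w"] corresponds_zero_right by metis
    then show "v = w"
      by simp
  qed
  ultimately show thesis
    using that[of S \<sigma>] S_add S_scale S_corr \<sigma>(4) by (simp add: bij_def)
qed

end

section \<open>Projections of rank one\<close>

context dual_pair
begin

text \<open>Dividing by \<open>\<beta> x y\<close> makes this a projection for any \<open>x\<close> and \<open>y\<close> with \<open>\<beta> x y \<noteq> 0\<close>, so
  that representatives of lines never have to be rescaled.\<close>

definition line_projection :: "'e \<Rightarrow> 'f \<Rightarrow> 'e \<Rightarrow> 'e" where
  "line_projection x y = (\<lambda>z. lscale (\<beta> z y * inverse (\<beta> x y)) x)"

abbreviation line :: "'e \<Rightarrow> 'e set" where
  "line x \<equiv> range (\<lambda>a. lscale a x)"

abbreviation perp :: "'f \<Rightarrow> 'e set" where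
  "perp y \<equiv> {z. \<beta> z y = 0}"

lemma in_line_self: "x \<in> line x"
  by (metis lscale_one rangeI)

lemma line_projection_mem:
  assumes "\<beta> x y \<noteq> 0"
  shows "line_projection x y \<in> \<P>"
proof -
  have "line_projection x y \<in> carrier \<R>"
    by (rule endo_if_adjoint[where g = "\<lambda>w. rscale y (inverse (\<beta> x y) * \<beta> x w)"])
      (simp add: line_projection_def form_lscale form_rscale mult.assoc)
  moreover have "line_projection x y \<circ> line_projection x y = line_projection x y"
    using assms by (simp add: fun_eq_iff line_projection_def form_lscale mult.assoc)
  ultimately show ?thesis
    by (simp add: continuous_projections_def)
qed

lemma range_line_projection:
  assumes "\<beta> x y \<noteq> 0"
  shows "range (line_projection x y) = line x"
proof
  show "line x \<subseteq> range (line_projection x y)"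
  proof
    fix w assume "w \<in> line x"
    then obtain a where "w = lscale a x"
      by blast
    then have "w = line_projection x y w"
      using assms by (simp add: line_projection_def form_lscale mult.assoc)
    then show "w \<in> range (line_projection x y)"
      by (metis rangeI)
  qed
qed (auto simp: line_projection_def)

lemma kernel_line_projection:
  assumes "\<beta> x y \<noteq> 0"
  shows "kernel_of (line_projection x y) = perp y"
proof -
  have "x \<noteq> 0"
    using assms form_zero by metis
  then show ?thesis
    using assms by (auto simp: kernel_of_def line_projection_def scale_eq_0_iff)
qed

lemma line_eq_if_mem:
  assumes "x \<in> line u" "x \<noteq> 0"
  shows "line x = line u"
proof -
  obtain a where a: "x = lscale a u"
    using assms(1) by blast
  then have "a \<noteq> 0"
    using assms(2) scale_zero_left by metis
  then have "lscale b u = lscale (b * inverse a) x" for b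
    by (simp add: a lscale_lscale mult.assoc)
  then show ?thesis
    by (auto simp: a lscale_lscale)
qed

lemma range_kernel_disjoint: "p \<in> \<P> \<Longrightarrow> x \<in> range p \<Longrightarrow> x \<in> kernel_of p \<Longrightarrow> x = 0"
  using projection_in_range_iff by (simp add: kernel_of_def)

lemma zero_projection: "(\<lambda>x. 0) \<in> \<P>"
proof -
  have "(\<lambda>x. 0) \<in> carrier \<R>"
    by (rule endo_if_adjoint[where g = "\<lambda>y. 0"]) (simp add: form_zero)
  then show ?thesis
    by (simp add: continuous_projections_def fun_eq_iff)
qed

lemma zero_le: "p \<in> \<P> \<Longrightarrow> proj_le (\<lambda>x. 0) p"
  using zero_projection by (simp add: proj_le_iff fun_eq_iff projectionD)

lemma proj_le_antisym: "p \<in> \<P> \<Longrightarrow> q \<in> \<P> \<Longrightarrow> proj_le p q \<Longrightarrow> proj_le q p \<Longrightarrow> p = q"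
  using proj_le_iff by metis

text \<open>With \<open>x = p(z)\<close>, \<open>\<beta>(x,y) = 1\<close> and \<open>p\<^sup>*\<close> the adjoint of \<open>p\<close>, take the projection onto the line
  of \<open>x\<close> along the annihilator of \<open>p\<^sup>*y\<close>.  Its image contains \<open>p(z)\<close> and its kernel omits \<open>z\<close>;
  so the atoms below \<open>p\<close> together determine both the image and the kernel of \<open>p\<close>.\<close>

lemma line_projection_below:
  assumes p: "p \<in> \<P>" and z: "p z \<noteq> 0"
  obtains x y where "\<beta> x y \<noteq> 0" "proj_le (line_projection x y) p" "line_projection x y z \<noteq> 0"
    "p z \<in> range (line_projection x y)"
proof -
  obtain g where g: "\<And>x y. \<beta> (p x) y = \<beta> x (g y)"
    using endo_adjoint projectionD(1)[OF p] by blast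
  define x where "x = p z"
  obtain y where y: "\<beta> x y = 1"
    using z unit_functional unfolding x_def by blast
  have px: "p x = x"
    by (simp add: x_def projectionD(2)[OF p])
  have xy: "\<beta> x (g y) \<noteq> 0"
    using y g[of x y] px by simp
  have "proj_le (line_projection x (g y)) p"
    unfolding proj_le_def range_line_projection[OF xy] kernel_line_projection[OF xy]
  proof
    have "lscale a x = p (lscale a x)" for a
      by (simp add: projectionD(5)[OF p] px)
    then show "line x \<subseteq> range p"
      by blast
    show "kernel_of p \<subseteq> perp (g y)"
      by (auto simp: kernel_of_def g[symmetric] form_zero)
  qed
  moreover have "z \<notin> kernel_of (line_projection x (g y))"
    using y by (simp add: kernel_line_projection[OF xy] g[symmetric] flip: x_def)
  then have "line_projection x (g y) z \<noteq> 0"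
    by (simp add: kernel_of_def)
  moreover have "p z \<in> range (line_projection x (g y))"
    using in_line_self[of x] by (simp add: range_line_projection[OF xy] flip: x_def)
  ultimately show thesis
    using that xy by blast
qed

lemma proj_le_if_line_projections:
  assumes p: "p \<in> \<P>" and q: "q \<in> \<P>"
    and le: "\<And>x y. \<beta> x y \<noteq> 0 \<Longrightarrow> proj_le (line_projection x y) p \<Longrightarrow>
      proj_le (line_projection x y) q"
  shows "proj_le p q"
proof -
  have "p z \<in> range q" for z
  proof (cases "p z = 0")
    case True
    then show ?thesis
      using projectionD(6)[OF q] by (metis rangeI)
  next
    case False
    then obtain x y where "\<beta> x y \<noteq> 0" "proj_le (line_projection x y) p"
        "p z \<in> range (line_projection x y)"
      using line_projection_below[OF p] by metis
    then show ?thesis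
      using le unfolding proj_le_def by blast
  qed
  moreover have "p z = 0" if "q z = 0" for z
  proof (rule ccontr)
    assume "p z \<noteq> 0"
    then obtain x y where xy: "\<beta> x y \<noteq> 0" "proj_le (line_projection x y) p"
        "line_projection x y z \<noteq> 0"
      using line_projection_below[OF p] by metis
    then have "kernel_of q \<subseteq> kernel_of (line_projection x y)"
      using le unfolding proj_le_def by blast
    then show False
      using that xy(3) by (auto simp: kernel_of_def)
  qed
  ultimately show ?thesis
    by (auto simp: proj_le_def kernel_of_def)
qed

definition atomic :: "('e \<Rightarrow> 'e) \<Rightarrow> bool" where
  "atomic p \<longleftrightarrow> p \<in> \<P> \<and> p \<noteq> (\<lambda>x. 0) \<and>
     (\<forall>q\<in>\<P>. proj_le q p \<longrightarrow> q = (\<lambda>x. 0) \<or> q = p)"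

text \<open>By \<open>line_projection_below\<close>, an atom is above, hence equal to, some projection onto a line.
  Conversely a nonzero projection below one onto a line has the same image, and its values
  depend only on those on the image.\<close>

lemma atomic_iff_line_projection:
  "atomic p \<longleftrightarrow> (\<exists>x y. \<beta> x y \<noteq> 0 \<and> p = line_projection x y)"
proof
  assume p: "atomic p"
  then obtain z where z: "p z \<noteq> 0"
    unfolding atomic_def by (meson ext)
  have "p \<in> \<P>"
    using p by (simp add: atomic_def)
  then obtain x y where xy: "\<beta> x y \<noteq> 0" "proj_le (line_projection x y) p"
      "line_projection x y z \<noteq> 0"
    using line_projection_below z by metis
  then have "line_projection x y = p"
    using p line_projection_mem[OF xy(1)] unfolding atomic_def by metis
  then show "\<exists>x y. \<beta> x y \<noteq> 0 \<and> p = line_projection x y"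
    using xy(1) by metis
next
  assume "\<exists>x y. \<beta> x y \<noteq> 0 \<and> p = line_projection x y"
  then obtain x y where xy: "\<beta> x y \<noteq> 0" and p_eq: "p = line_projection x y"
    by blast
  have p: "p \<in> \<P>"
    unfolding p_eq by (rule line_projection_mem[OF xy])
  have rp: "range p = line x"
    unfolding p_eq by (rule range_line_projection[OF xy])
  have x: "x \<noteq> 0"
    using xy form_zero by metis
  have px: "p x = x"
    using projection_in_range_iff[OF p] rp in_line_self by blast
  have "q = (\<lambda>x. 0) \<or> q = p" if q: "q \<in> \<P>" and le: "proj_le q p" for q
  proof (cases "q = (\<lambda>x. 0)")
    case False
    then obtain z where "q z \<noteq> 0"
      by (meson ext)
    moreover have "q z \<in> line x"
      using le rp unfolding proj_le_def by blast
    ultimately have "line (q z) = line x"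
      using line_eq_if_mem by blast
    then obtain a where "x = lscale a (q z)"
      using in_line_self by blast
    then have qx: "q x = x"
      by (simp add: projectionD[OF q])
    have "q w = p w" for w
    proof -
      obtain a where a: "p w = lscale a x"
        using rp by blast
      have "q w = q (p w)"
        using le proj_le_iff[OF q p] by (metis comp_apply)
      then show ?thesis
        by (simp add: a projectionD(5)[OF q] qx)
    qed
    then show ?thesis
      by blast
  qed simp
  then show "atomic p"
    using p px x unfolding atomic_def by metis
qed

lemma orthoposet_automorphism_zero:
  assumes "orthoposet_automorphism \<P> \<phi>"
  shows "\<phi> (\<lambda>x. 0) = (\<lambda>x. 0)"
proof -
  have bij: "bij_betw \<phi> \<P> \<P>"
    and le: "\<And>p q. p \<in> \<P> \<Longrightarrow> q \<in> \<P> \<Longrightarrow> proj_le (\<phi> p) (\<phi> q) \<longleftrightarrow> proj_le p q"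
    using assms by (simp_all add: orthoposet_automorphism_def)
  obtain p where p: "p \<in> \<P>" "\<phi> p = (\<lambda>x. 0)"
    using bij zero_projection unfolding bij_betw_def by (metis imageE)
  have "\<phi> (\<lambda>x. 0) \<in> \<P>"
    using bij zero_projection bij_betwE by blast
  moreover have "proj_le (\<phi> (\<lambda>x. 0)) (\<lambda>x. 0)"
    using le[OF zero_projection p(1)] zero_le[OF p(1)] p(2) by simp
  ultimately show ?thesis
    using proj_le_antisym zero_projection zero_le by blast
qed

lemma orthoposet_automorphism_atomic_iff:
  assumes auto: "orthoposet_automorphism \<P> \<phi>" and p: "p \<in> \<P>"
  shows "atomic (\<phi> p) \<longleftrightarrow> atomic p"
proof -
  have bij: "bij_betw \<phi> \<P> \<P>"
    and le: "\<And>p q. p \<in> \<P> \<Longrightarrow> q \<in> \<P> \<Longrightarrow> proj_le (\<phi> p) (\<phi> q) \<longleftrightarrow> proj_le p q"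
    using auto by (simp_all add: orthoposet_automorphism_def)
  have img: "\<phi> ` \<P> = \<P>"
    using bij by (simp add: bij_betw_def)
  have inj: "\<phi> q = \<phi> r \<longleftrightarrow> q = r" if "q \<in> \<P>" "r \<in> \<P>" for q r
    using bij that unfolding bij_betw_def by (metis inj_on_eq_iff)
  have zero: "\<phi> q = (\<lambda>x. 0) \<longleftrightarrow> q = (\<lambda>x. 0)" if "q \<in> \<P>" for q
    using inj[OF that zero_projection] orthoposet_automorphism_zero[OF auto] by simp
  have "(\<forall>r\<in>\<phi> ` \<P>. proj_le r (\<phi> p) \<longrightarrow> r = (\<lambda>x. 0) \<or> r = \<phi> p) \<longleftrightarrow>
      (\<forall>q\<in>\<P>. proj_le (\<phi> q) (\<phi> p) \<longrightarrow> \<phi> q = (\<lambda>x. 0) \<or> \<phi> q = \<phi> p)"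
    by blast
  also have "\<dots> \<longleftrightarrow> (\<forall>q\<in>\<P>. proj_le q p \<longrightarrow> q = (\<lambda>x. 0) \<or> q = p)"
    using le inj zero p by simp
  finally show ?thesis
    using p img zero[OF p] unfolding atomic_def by auto
qed

lemma orthoposet_automorphism_line_projection:
  assumes auto: "orthoposet_automorphism \<P> \<phi>" and xy: "\<beta> x y \<noteq> 0"
  obtains x' y' where "\<beta> x' y' \<noteq> 0" "\<phi> (line_projection x y) = line_projection x' y'"
  using orthoposet_automorphism_atomic_iff[OF auto line_projection_mem[OF xy]] xy
  unfolding atomic_iff_line_projection by metis

lemma orthoposet_automorphism_line_projection_onto:
  assumes auto: "orthoposet_automorphism \<P> \<phi>" and xy: "\<beta> x' y' \<noteq> 0"
  obtains x y where "\<beta> x y \<noteq> 0" "\<phi> (line_projection x y) = line_projection x' y'"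
proof -
  obtain p where p: "p \<in> \<P>" "\<phi> p = line_projection x' y'"
    using auto line_projection_mem[OF xy] unfolding orthoposet_automorphism_def bij_betw_def
    by (metis imageE)
  moreover have "atomic (line_projection x' y')"
    using xy unfolding atomic_iff_line_projection by blast
  ultimately have "atomic p"
    using orthoposet_automorphism_atomic_iff[OF auto] by metis
  then show thesis
    using that p(2) unfolding atomic_iff_line_projection by blast
qed

text \<open>Every atom below \<open>\<phi>(p)\<close> is the image of an atom below \<open>p\<close>, hence below \<open>\<psi>(p)\<close>.\<close>

lemma orthoposet_automorphism_eqI:
  assumes \<phi>: "orthoposet_automorphism \<P> \<phi>" and \<psi>: "orthoposet_automorphism \<P> \<psi>"
    and eq: "\<And>x y. \<beta> x y \<noteq> 0 \<Longrightarrow> \<phi> (line_projection x y) = \<psi> (line_projection x y)"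
    and p: "p \<in> \<P>"
  shows "\<phi> p = \<psi> p"
proof -
  have mem: "\<phi> p \<in> \<P>" if "orthoposet_automorphism \<P> \<phi>" for \<phi>
    using that p bij_betwE unfolding orthoposet_automorphism_def by blast
  have "proj_le (\<phi> p) (\<psi> p)"
    if \<phi>: "orthoposet_automorphism \<P> \<phi>" and \<psi>: "orthoposet_automorphism \<P> \<psi>"
      and eq: "\<And>x y. \<beta> x y \<noteq> 0 \<Longrightarrow> \<phi> (line_projection x y) = \<psi> (line_projection x y)"
    for \<phi> \<psi>
  proof (rule proj_le_if_line_projections[OF mem[OF \<phi>] mem[OF \<psi>]])
    fix x' y' assume "\<beta> x' y' \<noteq> 0" and le: "proj_le (line_projection x' y') (\<phi> p)"
    then obtain x y where xy: "\<beta> x y \<noteq> 0" "\<phi> (line_projection x y) = line_projection x' y'"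
      using orthoposet_automorphism_line_projection_onto[OF \<phi>] by metis
    then have "proj_le (line_projection x y) p"
      using le \<phi> p line_projection_mem unfolding orthoposet_automorphism_def by metis
    then have "proj_le (\<psi> (line_projection x y)) (\<psi> p)"
      using \<psi> p line_projection_mem[OF xy(1)] unfolding orthoposet_automorphism_def by blast
    then show "proj_le (line_projection x' y') (\<psi> p)"
      using eq xy by simp
  qed
  then show ?thesis
    using proj_le_antisym mem \<phi> \<psi> eq by metis
qed

lemma common_functional:
  assumes "x \<noteq> 0" "x' \<noteq> 0"
  obtains y where "\<beta> x y \<noteq> 0" "\<beta> x' y \<noteq> 0"
proof -
  obtain y y' where "\<beta> x y = 1" "\<beta> x' y' = 1"
    using assms unit_functional by metis
  then show thesis
    using that[of y] that[of y'] that[of "y + y'"] by (cases "\<beta> x y' = 0"; cases "\<beta> x' y = 0")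
      (auto simp: form_add_right)
qed

lemma common_vector:
  assumes "y \<noteq> 0" "y' \<noteq> 0"
  obtains x where "\<beta> x y \<noteq> 0" "\<beta> x y' \<noteq> 0"
proof -
  obtain x x' where "\<beta> x y = 1" "\<beta> x' y' = 1"
    using assms unit_vector by metis
  then show thesis
    using that[of x] that[of x'] that[of "x + x'"] by (cases "\<beta> x' y = 0"; cases "\<beta> x y' = 0")
      (auto simp: form_add_left)
qed

end

section \<open>Even automorphisms\<close>

locale even_projection_automorphism = dual_pair lscale rscale \<beta>
  for lscale :: "'k::division_ring \<Rightarrow> 'e::ab_group_add \<Rightarrow> 'e"
    and rscale :: "'f::ab_group_add \<Rightarrow> 'k \<Rightarrow> 'f"
    and \<beta> :: "'e \<Rightarrow> 'f \<Rightarrow> 'k" +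
  fixes \<phi> :: "('e \<Rightarrow> 'e) \<Rightarrow> 'e \<Rightarrow> 'e"
  assumes even: "even_automorphism \<P> \<phi>"
begin

lemma orthoposet: "orthoposet_automorphism \<P> \<phi>"
  using even by (simp add: even_automorphism_def)

lemma \<phi>_mem: "p \<in> \<P> \<Longrightarrow> \<phi> p \<in> \<P>"
  using orthoposet bij_betwE unfolding orthoposet_automorphism_def by blast

lemma \<phi>_inj: "p \<in> \<P> \<Longrightarrow> q \<in> \<P> \<Longrightarrow> \<phi> p = \<phi> q \<Longrightarrow> p = q"
  using orthoposet unfolding orthoposet_automorphism_def bij_betw_def by (metis inj_onD)

lemma range_cong: "p \<in> \<P> \<Longrightarrow> q \<in> \<P> \<Longrightarrow> range p = range q \<Longrightarrow> range (\<phi> p) = range (\<phi> q)"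
  using even unfolding even_automorphism_def by blast

text \<open>The kernel of a projection is the image of its complement.\<close>

lemma kernel_cong:
  assumes p: "p \<in> \<P>" and q: "q \<in> \<P>" and eq: "kernel_of p = kernel_of q"
  shows "kernel_of (\<phi> p) = kernel_of (\<phi> q)"
proof -
  have "range (\<phi> (proj_compl p)) = range (\<phi> (proj_compl q))"
    using eq p q by (intro range_cong proj_compl_mem) (simp_all add: kernel_eq_range_compl)
  moreover have "\<phi> (proj_compl p) = proj_compl (\<phi> p)" "\<phi> (proj_compl q) = proj_compl (\<phi> q)"
    using orthoposet p q unfolding orthoposet_automorphism_def by blast+
  ultimately show ?thesis
    by (simp add: kernel_eq_range_compl \<phi>_mem p q)
qed

abbreviation \<pi> :: "'e \<Rightarrow> 'f \<Rightarrow> 'e \<Rightarrow> 'e" where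
  "\<pi> \<equiv> line_projection"

lemma range_\<phi>_cong:
  assumes "\<beta> x y \<noteq> 0" "\<beta> x y' \<noteq> 0"
  shows "range (\<phi> (\<pi> x y)) = range (\<phi> (\<pi> x y'))"
  using assms by (intro range_cong line_projection_mem) (simp_all add: range_line_projection)

lemma kernel_\<phi>_cong:
  assumes "\<beta> x y \<noteq> 0" "\<beta> x' y \<noteq> 0"
  shows "kernel_of (\<phi> (\<pi> x y)) = kernel_of (\<phi> (\<pi> x' y))"
  using assms by (intro kernel_cong line_projection_mem) (simp_all add: kernel_line_projection)

text \<open>Evenness is an implication between equalities of images; this is its converse for atoms.  Replace
  the hyperplanes of both atoms by one common hyperplane: the images under \<open>\<phi>\<close> of the two new
  atoms have the same image and the same kernel, so the new atoms coincide.\<close>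

lemma line_eq_if_range_\<phi>_eq:
  assumes xy: "\<beta> x y \<noteq> 0" and xy': "\<beta> x' y' \<noteq> 0"
    and eq: "range (\<phi> (\<pi> x y)) = range (\<phi> (\<pi> x' y'))"
  shows "line x = line x'"
proof -
  have "x \<noteq> 0" "x' \<noteq> 0"
    using xy xy' form_zero by metis+
  then obtain z where z: "\<beta> x z \<noteq> 0" "\<beta> x' z \<noteq> 0"
    by (rule common_functional)
  have "range (\<phi> (\<pi> x z)) = range (\<phi> (\<pi> x' z))"
    using eq range_\<phi>_cong[OF xy z(1)] range_\<phi>_cong[OF xy' z(2)] by simp
  then have "\<phi> (\<pi> x z) = \<phi> (\<pi> x' z)"
    using kernel_\<phi>_cong[OF z] z by (intro projection_eqI \<phi>_mem line_projection_mem)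
  then have "\<pi> x z = \<pi> x' z"
    using z \<phi>_inj line_projection_mem by blast
  then show ?thesis
    using range_line_projection z by metis
qed

lemma perp_eq_if_kernel_\<phi>_eq:
  assumes xy: "\<beta> x y \<noteq> 0" and xy': "\<beta> x' y' \<noteq> 0"
    and eq: "kernel_of (\<phi> (\<pi> x y)) = kernel_of (\<phi> (\<pi> x' y'))"
  shows "perp y = perp y'"
proof -
  have "y \<noteq> 0" "y' \<noteq> 0"
    using xy xy' form_zero by metis+
  then obtain z where z: "\<beta> z y \<noteq> 0" "\<beta> z y' \<noteq> 0"
    by (rule common_vector)
  have "kernel_of (\<phi> (\<pi> z y)) = kernel_of (\<phi> (\<pi> z y'))"
    using eq kernel_\<phi>_cong[OF xy z(1)] kernel_\<phi>_cong[OF xy' z(2)] by simp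
  then have "\<phi> (\<pi> z y) = \<phi> (\<pi> z y')"
    using range_\<phi>_cong[OF z] z by (intro projection_eqI \<phi>_mem line_projection_mem)
  then have "\<pi> z y = \<pi> z y'"
    using z \<phi>_inj line_projection_mem by blast
  then show ?thesis
    using kernel_line_projection z by metis
qed

text \<open>The action on the lines of \<open>F\<close>, by representing vectors.\<close>

lemma functional_map_exists:
  obtains B where "B 0 = 0" "\<And>x y. \<beta> x y \<noteq> 0 \<Longrightarrow> kernel_of (\<phi> (\<pi> x y)) = perp (B y)"
proof -
  have "\<exists>y'. (y = 0 \<longrightarrow> y' = 0) \<and> (\<forall>x. \<beta> x y \<noteq> 0 \<longrightarrow> kernel_of (\<phi> (\<pi> x y)) = perp y')" for y
  proof (cases "y = 0")
    case True
    then show ?thesis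
      using form_zero(2) by blast
  next
    case False
    then obtain x where "\<beta> x y = 1"
      by (rule unit_vector)
    then have xy: "\<beta> x y \<noteq> 0"
      by simp
    obtain x' y' where xy': "\<beta> x' y' \<noteq> 0" "\<phi> (\<pi> x y) = \<pi> x' y'"
      using orthoposet_automorphism_line_projection[OF orthoposet xy] .
    have "kernel_of (\<phi> (\<pi> z y)) = perp y'" if "\<beta> z y \<noteq> 0" for z
      using kernel_\<phi>_cong[OF that xy] kernel_line_projection[OF xy'(1)] xy'(2) by simp
    then show ?thesis
      using False by blast
  qed
  then show thesis
    using that by metis
qed

text \<open>Here \<open>w\<close> represents the image of the line of \<open>x\<close>.  If \<open>\<beta>(x,z) \<noteq> 0\<close>, then \<open>\<phi>\<close> maps an
  atom with image \<open>Kx\<close> and kernel \<open>z\<^sup>\<bottom>\<close> to one with image \<open>Kw\<close> and kernel \<open>(B z)\<^sup>\<bottom>\<close>.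
  Conversely an atom with this image and kernel comes from an atom, whose image and kernel are
  recovered by \<open>line_eq_if_range_\<phi>_eq\<close> and \<open>perp_eq_if_kernel_\<phi>_eq\<close>.\<close>

lemma orthogonality_preserved:
  assumes B: "B 0 = 0" "\<And>x y. \<beta> x y \<noteq> 0 \<Longrightarrow> kernel_of (\<phi> (\<pi> x y)) = perp (B y)"
    and xy: "\<beta> x y \<noteq> 0" and wy: "\<beta> w y' \<noteq> 0" and eq: "\<phi> (\<pi> x y) = \<pi> w y'"
  shows "\<beta> w (B z) = 0 \<longleftrightarrow> \<beta> x z = 0"
proof -
  have rng: "range (\<phi> (\<pi> x y)) = line w"
    using range_line_projection[OF wy] eq by simp
  have x: "x \<noteq> 0" and w: "w \<noteq> 0"
    using xy wy form_zero by metis+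
  have "\<beta> w (B z) \<noteq> 0" if xz: "\<beta> x z \<noteq> 0"
  proof -
    have "w \<in> range (\<phi> (\<pi> x z))"
      using range_\<phi>_cong[OF xy xz] rng in_line_self[of w] by metis
    then have "w \<notin> kernel_of (\<phi> (\<pi> x z))"
      using range_kernel_disjoint \<phi>_mem line_projection_mem xz w by blast
    then show ?thesis
      using B(2)[OF xz] by simp
  qed
  moreover have "\<beta> x z \<noteq> 0" if wz: "\<beta> w (B z) \<noteq> 0"
  proof -
    obtain x1 y1 where 1: "\<beta> x1 y1 \<noteq> 0" "\<phi> (\<pi> x1 y1) = \<pi> w (B z)"
      using orthoposet_automorphism_line_projection_onto[OF orthoposet wz] .
    have "line x1 = line x"
      using line_eq_if_range_\<phi>_eq[OF 1(1) xy] rng 1(2) range_line_projection[OF wz] by simp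
    then have "x \<in> range (\<pi> x1 y1)"
      using in_line_self[of x] range_line_projection[OF 1(1)] by metis
    then have "x \<notin> kernel_of (\<pi> x1 y1)"
      using range_kernel_disjoint line_projection_mem[OF 1(1)] x by blast
    then have "x \<notin> perp y1"
      using kernel_line_projection[OF 1(1)] by simp
    moreover have "z \<noteq> 0"
      using wz B(1) form_zero by metis
    then obtain x2 where "\<beta> x2 z = 1"
      by (rule unit_vector)
    then have x2: "\<beta> x2 z \<noteq> 0"
      by simp
    have "perp y1 = perp z"
      using perp_eq_if_kernel_\<phi>_eq[OF 1(1) x2] B(2)[OF x2] 1(2) kernel_line_projection[OF wz]
      by simp
    ultimately show ?thesis
      by blast
  qed
  ultimately show ?thesis
    by blast
qed

lemma orthogonality_correspondence_exists:
  assumes dim: "\<And>u v. \<exists>w. \<forall>a b. w \<noteq> lscale a u + lscale b v"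
  obtains B where "orthogonality_correspondence lscale rscale \<beta> B"
    "\<And>x y. \<beta> x y \<noteq> 0 \<Longrightarrow> kernel_of (\<phi> (\<pi> x y)) = perp (B y)"
    "\<And>x y. \<beta> x y \<noteq> 0 \<Longrightarrow>
       \<exists>w. w \<noteq> 0 \<and> range (\<phi> (\<pi> x y)) = line w \<and> (\<forall>z. \<beta> w (B z) = 0 \<longleftrightarrow> \<beta> x z = 0)"
proof -
  obtain B where B: "B 0 = 0" "\<And>x y. \<beta> x y \<noteq> 0 \<Longrightarrow> kernel_of (\<phi> (\<pi> x y)) = perp (B y)"
    using functional_map_exists by metis
  have image: "\<exists>w. w \<noteq> 0 \<and> range (\<phi> (\<pi> x y)) = line w \<and> (\<forall>z. \<beta> w (B z) = 0 \<longleftrightarrow> \<beta> x z = 0)"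
    if xy: "\<beta> x y \<noteq> 0" for x y
  proof -
    obtain w y' where w: "\<beta> w y' \<noteq> 0" "\<phi> (\<pi> x y) = \<pi> w y'"
      using orthoposet_automorphism_line_projection[OF orthoposet xy] .
    have "w \<noteq> 0"
      using w(1) form_zero by metis
    then show ?thesis
      using range_line_projection[OF w(1)] w(2) orthogonality_preserved[OF B xy w] by metis
  qed
  have "orthogonality_correspondence lscale rscale \<beta> B"
  proof
    fix y'
    show "\<exists>y a. y' = rscale (B y) a"
    proof (cases "y' = 0")
      case True
      then show ?thesis
        using in_right_line_if_perp[of "B 0" y'] form_zero(2) by blast
    next
      case False
      then obtain x' where "\<beta> x' y' = 1"
        by (rule unit_vector)
      then have xy': "\<beta> x' y' \<noteq> 0"
        by simp
      obtain x y where xy: "\<beta> x y \<noteq> 0" "\<phi> (\<pi> x y) = \<pi> x' y'"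
        using orthoposet_automorphism_line_projection_onto[OF orthoposet xy'] .
      have "perp y' = perp (B y)"
        using B(2)[OF xy(1)] xy(2) kernel_line_projection[OF xy'] by simp
      then show ?thesis
        using in_right_line_if_perp[of "B y" y'] by blast
    qed
  next
    fix v
    show "\<exists>w. \<forall>y. \<beta> w (B y) = 0 \<longleftrightarrow> \<beta> v y = 0"
    proof (cases "v = 0")
      case True
      then show ?thesis
        using form_zero(1) by metis
    next
      case False
      then obtain y where "\<beta> v y = 1"
        by (rule unit_functional)
      then show ?thesis
        using image[of v y] by auto
    qed
  next
    fix w
    show "\<exists>v. \<forall>y. \<beta> w (B y) = 0 \<longleftrightarrow> \<beta> v y = 0"
    proof (cases "w = 0")
      case True
      then show ?thesis
        using form_zero(1) by metis
    next
      case False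
      then obtain y' where "\<beta> w y' = 1"
        by (rule unit_functional)
      then have wy: "\<beta> w y' \<noteq> 0"
        by simp
      obtain x y where xy: "\<beta> x y \<noteq> 0" "\<phi> (\<pi> x y) = \<pi> w y'"
        using orthoposet_automorphism_line_projection_onto[OF orthoposet wy] .
      show ?thesis
        using orthogonality_preserved[OF B xy(1) wy xy(2)] by blast
    qed
  next
    fix u v
    show "\<exists>w. \<forall>a b. w \<noteq> lscale a u + lscale b v"
      by (rule dim)
  qed
  then show thesis
    using that B(2) image by blast
qed

end

section \<open>The ring automorphism\<close>

context orthogonality_correspondence
begin

text \<open>Let \<open>h(f) = S f S\<^sup>-\<^sup>1\<close>.  The factors of \<open>S\<close> and \<open>S\<^sup>-\<^sup>1\<close> cancel, as \<open>\<sigma>\<close> is onto, which makes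
  \<open>h(f)\<close> linear.  It is continuous as \<open>S\<close> carries the annihilator of \<open>y\<close> to that of \<open>B y\<close>, and every
  vector of \<open>F\<close> is a multiple of some \<open>B y\<close>.\<close>

lemma ring_automorphism_exists:
  obtains S h where "h \<in> ring_iso \<R> \<R>" "bij S" "\<And>v. corresponds v (S v)"
    "\<And>a v. \<exists>b. S (lscale a v) = lscale b (S v)"
    "\<And>f v. h f (S v) = S (f v)"
proof -
  obtain S \<sigma> where add: "\<And>v w. S (v + w) = S v + S w"
    and scale: "\<And>a v. S (lscale a v) = lscale (\<sigma> a) (S v)"
    and bij: "bij S" and surj: "surj \<sigma>" and corr: "\<And>v. corresponds v (S v)"
    using semilinear_bijection_exists by metis
  have inj: "S v = S w \<longleftrightarrow> v = w" for v w
    using bij by (metis bij_pointE)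
  have onto: "\<exists>v. w = S v" for w
    using bij by (metis bij_pointE)
  define T where "T = inv_into UNIV S"
  have T_S: "T (S v) = v" for v
    using bij by (simp add: T_def bij_is_inj)
  have S_T: "S (T w) = w" for w
    using bij by (simp add: T_def bij_is_surj surj_f_inv_f)
  have orth: "\<beta> (S v) (B y) = 0 \<longleftrightarrow> \<beta> v y = 0" for v y
    using corr by (simp add: corresponds_def)
  define h where "h f = S \<circ> f \<circ> T" for f
  have h_S: "h f (S v) = S (f v)" for f v
    by (simp add: h_def T_S)
  have h_mem: "h f \<in> carrier \<R>" if f: "f \<in> carrier \<R>" for f
  proof -
    have lin: "f (v + w) = f v + f w" "f (lscale a v) = lscale a (f v)" for v w a
      using endo_linear[OF f] by (simp_all add: left_linear_def)
    have "left_linear lscale (h f)"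
      unfolding left_linear_def
    proof (intro conjI allI)
      fix w w'
      obtain v v' where v: "w = S v" "w' = S v'"
        using onto by metis
      show "h f (w + w') = h f w + h f w'"
        by (simp add: v h_S lin add flip: add)
      fix c
      obtain a where "c = \<sigma> a"
        using surj by (metis surjE)
      then show "h f (lscale c w) = lscale c (h f w)"
        by (simp add: v h_S lin scale flip: scale)
    qed
    moreover have "\<exists>y''. \<forall>w. \<beta> w y'' = 0 \<longrightarrow> \<beta> (h f w) y' = 0" for y'
    proof -
      obtain y c where y: "y' = rscale (B y) c"
        using onto_lines by blast
      obtain g where g: "\<And>x y. \<beta> (f x) y = \<beta> x (g y)"
        using endo_adjoint[OF f] by blast
      have "\<beta> (h f (S v)) y' = 0" if "\<beta> (S v) (B (g y)) = 0" for v
        using that orth[of v "g y"] orth[of "f v" y] by (simp add: y form_rscale h_S g)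
      then show ?thesis
        using onto by metis
    qed
    ultimately show ?thesis
      using endo_iff(1) by blast
  qed
  have onto_h: "\<exists>f\<in>carrier \<R>. h f = g" if g: "g \<in> carrier \<R>" for g
  proof
    let ?f = "T \<circ> g \<circ> S"
    show "h ?f = g"
      by (simp add: h_def fun_eq_iff S_T)
    have lin: "g (v + w) = g v + g w" "g (lscale a v) = lscale a (g v)" for v w a
      using endo_linear[OF g] by (simp_all add: left_linear_def)
    have S_f: "S (?f v) = g (S v)" for v
      by (simp add: S_T)
    have "left_linear lscale ?f"
      unfolding left_linear_def
    proof (intro conjI allI)
      fix v w a
      have "S (?f (v + w)) = S (?f v + ?f w)"
        unfolding add S_f lin ..
      then show "?f (v + w) = ?f v + ?f w"
        using inj by blast
      have "S (?f (lscale a v)) = S (lscale a (?f v))"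
        unfolding scale S_f lin ..
      then show "?f (lscale a v) = lscale a (?f v)"
        using inj by blast
    qed
    moreover have "\<exists>y'. \<forall>v. \<beta> v y' = 0 \<longrightarrow> \<beta> (?f v) y = 0" for y
    proof -
      obtain k where k: "\<And>x y. \<beta> (g x) y = \<beta> x (k y)"
        using endo_adjoint[OF g] by blast
      obtain z c where z: "k (B y) = rscale (B z) c"
        using onto_lines by blast
      have "\<beta> (?f v) y = 0" if "\<beta> v z = 0" for v
        using that orth[of v z] orth[of "?f v" y] by (simp only: S_f k z form_rscale) simp
      then show ?thesis
        by blast
    qed
    ultimately show "?f \<in> carrier \<R>"
      using endo_iff(1) by blast
  qed
  have "inj_on h (carrier \<R>)"
  proof (rule inj_onI)
    fix f g assume "h f = h g"
    then have "S (f v) = S (g v)" for v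
      by (metis h_S)
    then show "f = g"
      using inj by blast
  qed
  moreover have "h ` carrier \<R> = carrier \<R>"
    using h_mem onto_h by blast
  moreover have "h \<in> ring_hom \<R> \<R>"
    proof (rule ring_hom_memI)
    show "h f \<in> carrier \<R>" if "f \<in> carrier \<R>" for f
      by (rule h_mem[OF that])
  qed (simp_all add: endo_ring_ops fun_eq_iff h_def T_S S_T add)
  ultimately have "h \<in> ring_iso \<R> \<R>"
    by (simp add: ring_iso_def bij_betw_def)
  then show thesis
    using that bij corr scale h_S by metis
qed

end

context even_projection_automorphism
begin

theorem extends_to_ring_automorphism:
  assumes dim: "\<And>u v. \<exists>w. \<forall>a b. w \<noteq> lscale a u + lscale b v"
  shows "\<exists>h\<in>ring_iso \<R> \<R>. \<forall>p\<in>\<P>. h p = \<phi> p"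
proof -
  obtain B where "orthogonality_correspondence lscale rscale \<beta> B"
    and ker: "\<And>x y. \<beta> x y \<noteq> 0 \<Longrightarrow> kernel_of (\<phi> (\<pi> x y)) = perp (B y)"
    and rng: "\<And>x y. \<beta> x y \<noteq> 0 \<Longrightarrow>
       \<exists>w. w \<noteq> 0 \<and> range (\<phi> (\<pi> x y)) = line w \<and> (\<forall>z. \<beta> w (B z) = 0 \<longleftrightarrow> \<beta> x z = 0)"
    by (rule orthogonality_correspondence_exists[OF dim]) (rule that)
  then interpret orthogonality_correspondence lscale rscale \<beta> B
    by simp
  obtain S h where h: "h \<in> ring_iso \<R> \<R>" and bij: "bij S" and corr: "\<And>v. corresponds v (S v)"
    and S_scale: "\<And>a v. \<exists>b. S (lscale a v) = lscale b (S v)"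
    and h_S: "\<And>f v. h f (S v) = S (f v)"
    by (rule ring_automorphism_exists) (rule that)
  have onto: "\<exists>v. w = S v" for w
    using bij by (metis bij_pointE)
  have h_auto: "orthoposet_automorphism \<P> (restrict h \<P>)"
    using even_automorphism_of_ring_iso[OF h] by (simp add: even_automorphism_def)
  have h_mem: "h p \<in> \<P>" if "p \<in> \<P>" for p
    using h_auto that bij_betwE unfolding orthoposet_automorphism_def by fastforce
  have agree: "h (\<pi> x y) = \<phi> (\<pi> x y)" if xy: "\<beta> x y \<noteq> 0" for x y
  proof (rule projection_eqI)
    let ?p = "\<pi> x y"
    show p: "h ?p \<in> \<P>" and "\<phi> ?p \<in> \<P>"
      using xy h_mem \<phi>_mem line_projection_mem by blast+
    have x: "x \<noteq> 0"
      using xy form_zero by metis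
    have Sx: "S x \<noteq> 0"
      using corr[of x] corresponds_zero_right x by metis
    have S0: "S v = 0 \<longleftrightarrow> v = 0" for v
      using corr[of v] corresponds_zero_right corresponds_zero_left by metis
    have "w \<in> kernel_of (h ?p) \<longleftrightarrow> w \<in> perp (B y)" for w
    proof -
      obtain v where v: "w = S v"
        using onto by blast
      have "w \<in> kernel_of (h ?p) \<longleftrightarrow> v \<in> kernel_of ?p"
        by (simp add: v kernel_of_def h_S S0)
      also have "\<dots> \<longleftrightarrow> w \<in> perp (B y)"
        using kernel_line_projection[OF xy] corr[of v] by (simp add: v corresponds_def)
      finally show ?thesis .
    qed
    then show "kernel_of (h ?p) = kernel_of (\<phi> ?p)"
      using ker[OF xy] by blast
    have "?p x = x"
      using projection_in_range_iff[OF line_projection_mem[OF xy]] range_line_projection[OF xy]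
        in_line_self by blast
    then have "lscale a (S x) = h ?p (lscale a (S x))" for a
      using projectionD(5)[OF p] h_S by metis
    moreover have "h ?p w \<in> line (S x)" for w
    proof -
      obtain v where v: "w = S v"
        using onto by blast
      obtain a where "?p v = lscale a x"
        using range_line_projection[OF xy] by blast
      then show ?thesis
        using S_scale[of a x] by (auto simp: v h_S)
    qed
    ultimately have "range (h ?p) = line (S x)"
      by blast
    moreover obtain w where w: "w \<noteq> 0" "range (\<phi> ?p) = line w" "corresponds x w"
      using rng[OF xy] unfolding corresponds_def by metis
    moreover have "S x \<in> line w"
      using corresponds_unique_right[OF w(3) corr] by blast
    ultimately show "range (h ?p) = range (\<phi> ?p)"
      using line_eq_if_mem[of "S x" w] Sx by simp
  qed
  have "\<phi> p = restrict h \<P> p" if "p \<in> \<P>" for p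
  proof (rule orthoposet_automorphism_eqI[OF orthoposet h_auto _ that])
    show "\<phi> (\<pi> x y) = restrict h \<P> (\<pi> x y)" if "\<beta> x y \<noteq> 0" for x y
      using agree[OF that] line_projection_mem[OF that] by simp
  qed
  then show ?thesis
    using h by (metis restrict_apply')
qed

end

theorem proposition5:
  fixes lscale :: "'k::division_ring \<Rightarrow> 'e::ab_group_add \<Rightarrow> 'e"
    and rscale :: "'f::ab_group_add \<Rightarrow> 'k \<Rightarrow> 'f"
    and \<beta> :: "'e \<Rightarrow> 'f \<Rightarrow> 'k"
  assumes "dual_pair lscale rscale \<beta>"
  shows
    "(\<forall>h \<in> ring_iso (continuous_endo_ring lscale rscale \<beta>) (continuous_endo_ring lscale rscale \<beta>).
        even_automorphism (continuous_projections lscale rscale \<beta>)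
          (restrict h (continuous_projections lscale rscale \<beta>))) \<and>
     (\<forall>h \<in> ring_anti_automorphisms (continuous_endo_ring lscale rscale \<beta>).
        odd_automorphism (continuous_projections lscale rscale \<beta>)
          (restrict h (continuous_projections lscale rscale \<beta>))) \<and>
     (left_dim lscale \<ge> 4 \<longrightarrow>
       (\<forall>\<phi>. even_automorphism (continuous_projections lscale rscale \<beta>) \<phi> \<longrightarrow>
         (\<exists>h \<in> ring_iso (continuous_endo_ring lscale rscale \<beta>) (continuous_endo_ring lscale rscale \<beta>).
            \<forall>p \<in> continuous_projections lscale rscale \<beta>. h p = \<phi> p)))"
proof -
  interpret dual_pair lscale rscale \<beta>
    by (rule assms)
  have "\<exists>h\<in>ring_iso \<R> \<R>. \<forall>p\<in>\<P>. h p = \<phi> p"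
    if dim: "left_dim lscale \<ge> 4" and even: "even_automorphism \<P> \<phi>" for \<phi>
  proof -
    interpret even_projection_automorphism lscale rscale \<beta> \<phi>
      by unfold_locales (rule even)
    have "(3::enat) \<le> 4"
      by (simp add: numeral_eq_enat)
    then have "left_dim lscale \<ge> 3"
      using dim by (rule order_trans)
    then show ?thesis
      by (intro extends_to_ring_automorphism not_in_plane_if_dim)
  qed
  then show ?thesis
    using even_automorphism_of_ring_iso odd_automorphism_of_anti_automorphism by blast
qed

end
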